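(* Let $M^\star\in\mathbb{R}^{m\times n}$, $k=\min(m,n)$, with singular value decomposition $M^\star=P\Sigma Q^\top$, $\Sigma=\mathrm{diag}(\sigma_1,\dots,\sigma_k)$, $\sigma_1>\sigma_2>\cdots>\sigma_k>0$. Let $W^\star$ be the unique minimizer over $W\in\mathbb{R}^{m\times n}$ of $$\Phi(W)=\frac14\|W-2M^\star\|_F^2+\frac1{4k}\|W\|_\star^2.$$ Then $W^\star=M^\star$ if and only if $\sigma_1=\sigma_2=\cdots=\sigma_k$. Consequently, under the assumption $\sigma_1>\cdots>\sigma_k$, every global minimizer $(U,V)\in\mathbb{R}^{m\times k}\times\mathbb{R}^{n\times k}$ of $$\frac{1}{2^k-1}\sum_{\emptyset\ne S\subseteq\{1,\dots,k\}}\|U\Pi_SV^\top-M^\star\|_F^2$$ satisfies $\|UV^\top-M^\star\|_F^2=\|W^\star-M^\star\|_F^2>0$.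
   Context: $\|\cdot\|_F$ is the Frobenius norm and $\|\cdot\|_\star$ the nuclear norm (sum of singular values). For $S\subseteq\{1,\dots,k\}$, $\Pi_S$ is the $k\times k$ diagonal matrix with $(\Pi_S)_{ii}=1$ if $i\in S$ and $0$ otherwise.
   Formalization: The strict inequality ‖W*−M*‖_F² > 0 is proved for k ≥ 2; for k = 1 the ordering of the σ_i is vacuous and W* = M*, so it fails. The equivalence is proved for σ_1 ≥ … ≥ σ_k > 0, which includes the strictly ordered case. *)

theory Defs
  imports "Jordan_Normal_Form.Matrix"
begin

definition frob_norm :: "real mat \<Rightarrow> real" where
  "frob_norm A = sqrt (\<Sum>i<dim_row A. \<Sum>j<dim_col A. (A $$ (i,j))^2)"

definition diag_k :: "nat \<Rightarrow> (nat \<Rightarrow> real) \<Rightarrow> real mat" where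
  "diag_k k s = mat k k (\<lambda>(i,j). if i = j then s i else 0)"

(* Pi_S for S a subset of {0..<k} (0-based indices) *)
definition Pi_S :: "nat \<Rightarrow> nat set \<Rightarrow> real mat" where
  "Pi_S k S = mat k k (\<lambda>(i,j). if i = j \<and> i \<in> S then 1 else 0)"

definition is_svd :: "real mat \<Rightarrow> real mat \<Rightarrow> (nat \<Rightarrow> real) \<Rightarrow> real mat \<Rightarrow> bool" where
  "is_svd W P s Q \<longleftrightarrow>
     (let m = dim_row W; n = dim_col W; k = min m n in
       P \<in> carrier_mat m k \<and> Q \<in> carrier_mat n k \<and>
       transpose_mat P * P = 1\<^sub>m k \<and> transpose_mat Q * Q = 1\<^sub>m k \<and>
       (\<forall>i<k. 0 \<le> s i) \<and> (\<forall>i j. i \<le> j \<and> j < k \<longrightarrow> s j \<le> s i) \<and>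
       W = P * diag_k k s * transpose_mat Q)"

definition nuc_norm :: "real mat \<Rightarrow> real" where
  "nuc_norm W = (THE t. \<exists>P s Q. is_svd W P s Q \<and>
                    t = (\<Sum>i<min (dim_row W) (dim_col W). s i))"

definition Phi :: "nat \<Rightarrow> real mat \<Rightarrow> real mat \<Rightarrow> real" where
  "Phi k M W = (1/4) * (frob_norm (W - 2 \<cdot>\<^sub>m M))^2 + (1 / (4 * real k)) * (nuc_norm W)^2"

definition dropout_loss :: "nat \<Rightarrow> real mat \<Rightarrow> real mat \<Rightarrow> real mat \<Rightarrow> real" where
  "dropout_loss k M U V = (1 / (2^k - 1)) *
     (\<Sum>S\<in>{S. S \<subseteq> {0..<k} \<and> S \<noteq> {}}. (frob_norm (U * Pi_S k S * transpose_mat V - M))^2)"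

end

theory Submission
  imports Defs "HOL-Analysis.Function_Topology" "HOL-Analysis.Convex"
begin

text \<open>
  Let \<open>\<tau>\<close> solve \<open>k \<tau> = \<Sum>i. max (2 \<sigma> i - \<tau>) 0\<close> and let \<open>W0\<close> have the singular vectors of \<open>M\<close> and the singular
  values \<open>max (2 \<sigma> i - \<tau>) 0\<close>. Then \<open>2 M - W0\<close> is \<open>\<tau>\<close> times a contraction, it pairs with \<open>W0\<close> to \<open>\<tau>\<close> times the
  nuclear norm of \<open>W0\<close>, and completing squares gives \<open>\<Phi> W0 + \<parallel>W - W0\<parallel>\<^sup>2 / 4 \<le> \<Phi> W\<close>, so \<open>W0\<close> is the
  minimizer. It equals \<open>M\<close> iff every \<open>\<sigma> i\<close> equals \<open>\<tau>\<close>.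

  Averaging over all subsets, the dropout loss is, up to an affine rescaling,
  \<open>\<parallel>U V\<^sup>T - 2 M\<parallel>\<^sup>2 / 4 + (\<Sum>i. \<parallel>u i\<parallel>\<^sup>2 \<parallel>v i\<parallel>\<^sup>2) / 4\<close>. By Cauchy-Schwarz the same certificate bounds it below
  by \<open>\<Phi> W0 + \<parallel>U V\<^sup>T - W0\<parallel>\<^sup>2 / 4\<close>. The bound is attained by a factorization of \<open>W0\<close> whose columns all have
  squared length \<open>\<tau>\<close>, obtained from the singular vectors by an orthogonal matrix that equalizes a diagonal.

  The nuclear norm of an arbitrary matrix enters through its singular value decomposition, which is
  constructed by repeatedly maximizing the bilinear form on the unit spheres and subtracting the
  rank-one part.
\<close>

section \<open>Finite-dimensional linear algebra with coordinate functions\<close>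

text \<open>Vectors are functions on the naturals of which only the first \<open>m\<close> values
  count. The dimension is thus a parameter, and the product topology on
  \<open>nat \<Rightarrow> real\<close> supplies compactness.\<close>

definition ip :: "nat \<Rightarrow> (nat \<Rightarrow> real) \<Rightarrow> (nat \<Rightarrow> real) \<Rightarrow> real" where
  "ip m x y = (\<Sum>a<m. x a * y a)"

definition bil :: "nat \<Rightarrow> nat \<Rightarrow> (nat \<Rightarrow> nat \<Rightarrow> real) \<Rightarrow> (nat \<Rightarrow> real) \<Rightarrow> (nat \<Rightarrow> real) \<Rightarrow> real" where
  "bil m n R x y = ip m x (\<lambda>a. ip n (R a) y)"

definition orthonormal :: "nat \<Rightarrow> nat \<Rightarrow> (nat \<Rightarrow> nat \<Rightarrow> real) \<Rightarrow> bool" where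
  "orthonormal m k p \<longleftrightarrow> (\<forall>i<k. \<forall>j<k. ip m (p i) (p j) = (if i = j then 1 else 0))"

definition coord :: "nat \<Rightarrow> nat \<Rightarrow> real" where
  "coord c a = (if a = c then 1 else 0)"

lemma coord_same [simp]: "coord c c = 1"
  by (simp add: coord_def)

lemma ip_commute: "ip m x y = ip m y x"
  by (simp add: ip_def mult.commute)

lemma ip_cong: "(\<And>a. a < m \<Longrightarrow> x a = x' a) \<Longrightarrow> (\<And>a. a < m \<Longrightarrow> y a = y' a) \<Longrightarrow> ip m x y = ip m x' y'"
  by (simp add: ip_def)

lemma ip_diff_right: "ip m x (\<lambda>a. y a - z a) = ip m x y - ip m x z"
  by (simp add: ip_def right_diff_distrib sum_subtractf)

lemma ip_diff_left: "ip m (\<lambda>a. y a - z a) x = ip m y x - ip m z x"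
  by (simp add: ip_def left_diff_distrib sum_subtractf)

lemma ip_scale_right: "ip m x (\<lambda>a. c * y a) = c * ip m x y"
  by (simp add: ip_def sum_distrib_left mult_ac)

lemma ip_scale_left: "ip m (\<lambda>a. c * y a) x = c * ip m y x"
  by (simp add: ip_def sum_distrib_left mult_ac)

lemma ip_sum_right: "ip m x (\<lambda>a. \<Sum>i\<in>I. y i a) = (\<Sum>i\<in>I. ip m x (y i))"
  unfolding ip_def sum_distrib_left by (rule sum.swap)

lemma ip_sum_left: "ip m (\<lambda>a. \<Sum>i\<in>I. y i a) x = (\<Sum>i\<in>I. ip m (y i) x)"
  by (simp add: ip_commute[of m _ x] ip_sum_right)

lemma ip_self_nonneg: "0 \<le> ip m x x"
  by (simp add: ip_def sum_nonneg)

lemma ip_self_eq_0_D: "ip m x x \<le> 0 \<Longrightarrow> a < m \<Longrightarrow> x a = 0"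
  using sum_nonneg_eq_0_iff[of "{..<m}" "\<lambda>a. x a * x a"] ip_self_nonneg[of m x]
  by (auto simp: ip_def)

lemma ip_coord_right: "c < m \<Longrightarrow> ip m x (coord c) = x c"
  by (simp add: ip_def coord_def if_distrib[of "(*) _"] cong: if_cong)

lemma ip_coord_self: "c < m \<Longrightarrow> ip m (coord c) (coord c) = 1"
  by (simp add: ip_coord_right)

lemma L2_set_power2_eq_ip: "(L2_set x {..<m})\<^sup>2 = ip m x x"
  by (simp add: L2_set_def ip_def sum_nonneg power2_eq_square)

lemma L2_set_eq_sqrt_ip: "L2_set x {..<m} = sqrt (ip m x x)"
  by (simp add: L2_set_def ip_def power2_eq_square)

lemma bil_transpose: "bil m n R x y = ip n (\<lambda>b. ip m x (\<lambda>a. R a b)) y"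
  unfolding bil_def ip_def sum_distrib_left sum_distrib_right
  by (subst sum.swap) (simp add: mult_ac)

lemma bil_cong:
  "(\<And>a b. a < m \<Longrightarrow> b < n \<Longrightarrow> R a b = R' a b) \<Longrightarrow> bil m n R x y = bil m n R' x y"
  by (simp add: bil_def ip_def)

lemma bil_coord: "a < m \<Longrightarrow> b < n \<Longrightarrow> bil m n R (coord a) (coord b) = R a b"
  by (simp add: bil_def ip_coord_right ip_commute[of m "coord a"])

lemma bil_sum_rank_one:
  "bil m n (\<lambda>a b. \<Sum>i\<in>I. s i * p i a * q i b) x y = (\<Sum>i\<in>I. s i * ip m x (p i) * ip n (q i) y)"
proof -
  have "ip n (\<lambda>b. \<Sum>i\<in>I. s i * p i a * q i b) y = (\<Sum>i\<in>I. (s i * ip n (q i) y) * p i a)" for a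
    unfolding ip_sum_left ip_scale_left by (simp add: mult_ac)
  then show ?thesis
    unfolding bil_def by (simp add: ip_sum_right ip_scale_right) (simp add: mult_ac)
qed

text \<open>\<open>r x\<close> is \<open>x\<close> minus its orthogonal projection to the span of
  the \<open>p i\<close>. As it is orthogonal to that span, its pairing with itself equals its
  pairing with \<open>x\<close>, which is Pythagoras.\<close>

lemma orthonormal_residual:
  assumes "orthonormal m k p"
  defines "r \<equiv> \<lambda>x a. x a - (\<Sum>i<k. ip m (p i) x * p i a)"
  shows "l < k \<Longrightarrow> ip m (p l) (r x) = 0"
    and "ip m (r x) (r x) = ip m x x - (\<Sum>i<k. (ip m (p i) x)\<^sup>2)"
proof -
  have 1: "ip m (p l) (r x) = 0" if "l < k" for l
  proof -
    have "ip m (p l) (r x) = ip m (p l) x - (\<Sum>i<k. ip m (p i) x * ip m (p l) (p i))"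
      by (simp add: r_def ip_diff_right ip_sum_right ip_scale_right)
    also have "(\<Sum>i<k. ip m (p i) x * ip m (p l) (p i)) = (\<Sum>i<k. if i = l then ip m (p i) x else 0)"
      using assms(1) that by (intro sum.cong) (auto simp: orthonormal_def)
    also have "\<dots> = ip m (p l) x" using that by simp
    finally show ?thesis by simp
  qed
  then show "l < k \<Longrightarrow> ip m (p l) (r x) = 0" .
  have "ip m (r x) (r x) = ip m x (r x) - (\<Sum>i<k. ip m (p i) x * ip m (p i) (r x))"
    by (subst (1) r_def) (simp add: ip_diff_left ip_sum_left ip_scale_left)
  also have "\<dots> = ip m x (r x)" by (simp add: 1)
  also have "\<dots> = ip m x x - (\<Sum>i<k. ip m (p i) x * ip m x (p i))"
    by (simp add: r_def ip_diff_right ip_sum_right ip_scale_right)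
  also have "\<dots> = ip m x x - (\<Sum>i<k. (ip m (p i) x)\<^sup>2)"
    by (simp add: power2_eq_square ip_commute)
  finally show "ip m (r x) (r x) = ip m x x - (\<Sum>i<k. (ip m (p i) x)\<^sup>2)" .
qed

lemma ip_orthonormal_combination:
  assumes "orthonormal m k p"
  shows "ip m (\<lambda>a. \<Sum>i<k. c i * p i a) (\<lambda>a. \<Sum>i<k. c i * p i a) = (\<Sum>i<k. (c i)\<^sup>2)"
proof -
  have "ip m (\<lambda>a. \<Sum>i<k. c i * p i a) (\<lambda>a. \<Sum>i<k. c i * p i a)
      = (\<Sum>i<k. \<Sum>j<k. c i * (c j * ip m (p i) (p j)))"
    by (simp add: ip_sum_left ip_scale_left ip_sum_right ip_scale_right sum_distrib_left)
  also have "\<dots> = (\<Sum>i<k. \<Sum>j<k. if j = i then c i * c j else 0)"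
    using assms by (intro sum.cong) (auto simp: orthonormal_def)
  finally show ?thesis by (simp add: power2_eq_square)
qed

lemma bessel:
  assumes "orthonormal m k p"
  shows "(\<Sum>i<k. (ip m (p i) x)\<^sup>2) \<le> ip m x x"
proof -
  let ?r = "\<lambda>a. x a - (\<Sum>i<k. ip m (p i) x * p i a)"
  have "0 \<le> ip m ?r ?r" by (rule ip_self_nonneg)
  then show ?thesis unfolding orthonormal_residual(2)[OF assms] by simp
qed

text \<open>
  The summands are the squared lengths of the coordinate vectors projected to the orthogonal complement,
  so this trace identity yields both the extension and the completeness of orthonormal systems.
\<close>

lemma orthonormal_residual_total:
  assumes "orthonormal m k p"
  shows "(\<Sum>c<m. 1 - (\<Sum>i<k. (p i c)\<^sup>2)) = real m - real k"
proof -
  have "(\<Sum>c<m. \<Sum>i<k. (p i c)\<^sup>2) = (\<Sum>i<k. ip m (p i) (p i))"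
    unfolding ip_def power2_eq_square by (rule sum.swap)
  also have "\<dots> = real k" using assms by (simp add: orthonormal_def)
  finally show ?thesis by (simp add: sum_subtractf)
qed

text \<open>The residuals of the coordinate vectors have total squared length
  \<open>m - k > 0\<close>, so one of them is nonzero and can be normalized.\<close>

lemma orthonormal_extend:
  assumes "orthonormal m k p" "k < m"
  obtains x where "ip m x x = 1" "\<And>i. i < k \<Longrightarrow> ip m (p i) x = 0"
proof -
  have "\<exists>c<m. 0 < 1 - (\<Sum>i<k. (p i c)\<^sup>2)"
  proof (rule ccontr)
    assume "\<not> ?thesis"
    then have "(\<Sum>c<m. 1 - (\<Sum>i<k. (p i c)\<^sup>2)) \<le> 0" by (intro sum_nonpos) force
    then show False using orthonormal_residual_total[OF assms(1)] assms(2) by simp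
  qed
  then obtain c where c: "c < m" "0 < 1 - (\<Sum>i<k. (p i c)\<^sup>2)" by blast
  define r where "r = (\<lambda>a. coord c a - (\<Sum>i<k. ip m (p i) (coord c) * p i a))"
  have r0: "ip m (p l) r = 0" if "l < k" for l
    unfolding r_def by (rule orthonormal_residual(1)[OF assms(1) that])
  have rr: "0 < ip m r r"
    using c orthonormal_residual(2)[OF assms(1), of "coord c"]
    by (simp add: r_def ip_coord_right ip_coord_self)
  show thesis
  proof (rule that[of "\<lambda>a. (1 / sqrt (ip m r r)) * r a"])
    show "ip m (\<lambda>a. (1 / sqrt (ip m r r)) * r a) (\<lambda>a. (1 / sqrt (ip m r r)) * r a) = 1"
      unfolding ip_scale_left ip_scale_right using rr by simp
    show "ip m (p i) (\<lambda>a. (1 / sqrt (ip m r r)) * r a) = 0" if "i < k" for i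
      unfolding ip_scale_right using r0[OF that] by simp
  qed
qed

text \<open>For \<open>k = m\<close> the squared lengths of the residuals are nonnegative and add up
  to zero. So the residual of \<open>coord b\<close> vanishes, and its entry \<open>a\<close> is the
  claim.\<close>

lemma orthonormal_complete:
  assumes "orthonormal m m p" "a < m" "b < m"
  shows "(\<Sum>i<m. p i a * p i b) = (if a = b then 1 else 0)"
proof -
  define r where "r = (\<lambda>c. coord b c - (\<Sum>i<m. ip m (p i) (coord b) * p i c))"
  have nonneg: "0 \<le> 1 - (\<Sum>i<m. (p i c)\<^sup>2)" if "c < m" for c
    using bessel[OF assms(1), of "coord c"] that by (simp add: ip_coord_right ip_coord_self)
  have "1 - (\<Sum>i<m. (p i b)\<^sup>2) = 0"
    using orthonormal_residual_total[OF assms(1)] nonneg assms(3)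
      sum_nonneg_eq_0_iff[of "{..<m}" "\<lambda>c. 1 - (\<Sum>i<m. (p i c)\<^sup>2)"] by simp
  then have "ip m r r \<le> 0"
    using orthonormal_residual(2)[OF assms(1), of "coord b"] assms(3)
    by (simp add: r_def ip_coord_right ip_coord_self)
  from ip_self_eq_0_D[OF this assms(2)] show ?thesis
    using assms(3) by (simp add: r_def ip_coord_right coord_def mult.commute split: if_splits)
qed

text \<open>Forcing the entries from \<open>m\<close> on to be zero makes the sphere a closed subset
  of a product of compact sets, to which Tychonoff applies.\<close>

lemma compact_sphere:
  "compact {x :: nat \<Rightarrow> real. (\<forall>a\<ge>m. x a = 0) \<and> ip m x x = 1}"
proof -
  define B where "B = (\<lambda>a. if a < m then {-1..1::real} else {0})"
  have "compactin (product_topology (\<lambda>_. euclidean) UNIV) (PiE UNIV B)"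
    by (subst compactin_PiE) (auto simp: B_def)
  then have B: "compact (PiE UNIV B)"
    by (simp add: euclidean_product_topology)
  have closed: "closed {x :: nat \<Rightarrow> real. (\<forall>a\<ge>m. x a = 0) \<and> ip m x x = 1}"
    unfolding ip_def
    by (intro closed_Collect_conj closed_Collect_all closed_Collect_imp closed_Collect_eq
        open_Collect_const continuous_intros continuous_on_product_coordinates)
  have sub: "{x :: nat \<Rightarrow> real. (\<forall>a\<ge>m. x a = 0) \<and> ip m x x = 1} \<subseteq> PiE UNIV B"
  proof clarify
    fix x :: "nat \<Rightarrow> real" assume x: "\<forall>a\<ge>m. x a = 0" "ip m x x = 1"
    have "x a \<in> B a" for a
    proof (cases "a < m")
      case True
      have "x a * x a \<le> ip m x x"
        unfolding ip_def by (rule member_le_sum) (use True in auto)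
      then have "(x a)\<^sup>2 \<le> 1" using x by (simp add: power2_eq_square)
      then show ?thesis using True by (auto simp: B_def abs_square_le_1 abs_le_iff)
    qed (use x in \<open>auto simp: B_def\<close>)
    then show "x \<in> PiE UNIV B" by auto
  qed
  have "compact (PiE UNIV B \<inter> {x :: nat \<Rightarrow> real. (\<forall>a\<ge>m. x a = 0) \<and> ip m x x = 1})"
    by (rule compact_Int_closed[OF B closed])
  then show ?thesis using sub by (simp add: Int_absorb1)
qed

lemma bil_attains_max:
  assumes "0 < m" "0 < n"
  obtains x y where "ip m x x = 1" "ip n y y = 1"
    "\<And>x' y'. ip m x' x' = 1 \<Longrightarrow> ip n y' y' = 1 \<Longrightarrow> bil m n R x' y' \<le> bil m n R x y"
proof -
  define S :: "nat \<Rightarrow> (nat \<Rightarrow> real) set" where "S = (\<lambda>m. {x. (\<forall>a\<ge>m. x a = 0) \<and> ip m x x = 1})"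
  have "coord 0 \<in> S l" if "0 < l" for l using that by (simp add: S_def ip_coord_self) (simp add: coord_def)
  then have ne: "S m \<times> S n \<noteq> {}" using assms by blast
  have cp: "compact (S m \<times> S n)" unfolding S_def by (intro compact_Times compact_sphere)
  have c1: "continuous_on UNIV (\<lambda>z :: (nat \<Rightarrow> real) \<times> (nat \<Rightarrow> real). fst z a)"
    and c2: "continuous_on UNIV (\<lambda>z :: (nat \<Rightarrow> real) \<times> (nat \<Rightarrow> real). snd z a)" for a
    using continuous_on_compose2[OF continuous_on_product_coordinates[of a] continuous_on_fst[OF continuous_on_id]]
      continuous_on_compose2[OF continuous_on_product_coordinates[of a] continuous_on_snd[OF continuous_on_id]] by auto
  have "continuous_on UNIV (\<lambda>z. bil m n R (fst z) (snd z))"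
    unfolding bil_def ip_def by (intro continuous_intros c1 c2)
  then have ct: "continuous_on (S m \<times> S n) (\<lambda>z. bil m n R (fst z) (snd z))"
    by (rule continuous_on_subset) simp
  obtain z where z: "z \<in> S m \<times> S n"
    "\<forall>w\<in>S m \<times> S n. bil m n R (fst w) (snd w) \<le> bil m n R (fst z) (snd z)"
    using continuous_attains_sup[OF cp ne ct] by blast
  show thesis
  proof (rule that[of "fst z" "snd z"])
    show "ip m (fst z) (fst z) = 1" "ip n (snd z) (snd z) = 1" using z(1) by (auto simp: S_def)
    fix x' y' assume u: "ip m x' x' = 1" "ip n y' y' = 1"
    \<comment> \<open>Truncation changes neither lengths nor the value of the form, so the maximum
      over truncated vectors bounds all unit vectors.\<close>
    let ?x = "\<lambda>a. if a < m then x' a else 0" and ?y = "\<lambda>b. if b < n then y' b else 0"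
    have "ip m ?x ?x = ip m x' x'" "ip n ?y ?y = ip n y' y'" by (simp_all add: ip_def)
    then have "(?x, ?y) \<in> S m \<times> S n" using u by (simp add: S_def)
    from z(2)[rule_format, OF this] show "bil m n R x' y' \<le> bil m n R (fst z) (snd z)"
      by (simp add: bil_def ip_def)
  qed
qed

text \<open>This is the equality case of Cauchy-Schwarz: testing with \<open>w\<close> normalized
  gives that the length of \<open>w\<close> is at most \<open>s = ip m x w\<close>, while
  \<open>w - s x\<close> has squared length \<open>ip m w w - s\<^sup>2\<close>.\<close>

lemma maximal_ip_imp_parallel:
  assumes "ip m x x = 1" "\<And>x'. ip m x' x' = 1 \<Longrightarrow> ip m x' w \<le> ip m x w" "a < m"
  shows "w a = ip m x w * x a"
proof (cases "ip m w w = 0")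
  case True
  then have "w b = 0" if "b < m" for b using ip_self_eq_0_D[of m w b] that by simp
  then show ?thesis using assms(3) by (simp add: ip_def)
next
  case False
  then have N: "0 < ip m w w" using ip_self_nonneg[of m w] by simp
  define s where "s = ip m x w"
  have "ip m (\<lambda>a. (1 / sqrt (ip m w w)) * w a) (\<lambda>a. (1 / sqrt (ip m w w)) * w a) = 1"
    unfolding ip_scale_left ip_scale_right using N by simp
  from assms(2)[OF this] have "ip m w w / sqrt (ip m w w) \<le> s"
    unfolding ip_scale_left s_def by simp
  then have "sqrt (ip m w w) \<le> s" using N by (simp add: real_div_sqrt)
  then have "ip m w w \<le> s\<^sup>2" by (rule sqrt_le_D)
  moreover have "ip m (\<lambda>a. w a - s * x a) (\<lambda>a. w a - s * x a) = ip m w w - s\<^sup>2"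
    by (simp add: ip_diff_left ip_diff_right ip_scale_left ip_scale_right assms(1)
        ip_commute[of m w x] s_def[symmetric] power2_eq_square)
  ultimately have "w a - s * x a = 0" by (intro ip_self_eq_0_D[of m _ a] assms(3)) simp
  then show ?thesis by (simp add: s_def)
qed

section \<open>Existence of the singular value decomposition\<close>

text \<open>At a maximizing pair each vector is optimal for the other one fixed, hence parallel to
  the image of the other under \<open>R\<close> or its transpose. If the maximum \<open>t\<close> is
  positive, orthogonality to the earlier vectors follows because \<open>R\<close> annihilates them
  from either side; if \<open>t = 0\<close>, then \<open>R\<close> vanishes and any orthogonal unit
  vectors serve.\<close>

lemma exists_singular_pair:
  assumes p: "orthonormal m j p" and q: "orthonormal n j q" and j: "j < m" "j < n"
    and Rq: "\<And>i a. i < j \<Longrightarrow> a < m \<Longrightarrow> ip n (R a) (q i) = 0"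
    and Rp: "\<And>i b. i < j \<Longrightarrow> b < n \<Longrightarrow> ip m (p i) (\<lambda>a. R a b) = 0"
  obtains x y t where "ip m x x = 1" "ip n y y = 1" "0 \<le> t"
    "\<And>i. i < j \<Longrightarrow> ip m (p i) x = 0" "\<And>i. i < j \<Longrightarrow> ip n (q i) y = 0"
    "\<And>a. a < m \<Longrightarrow> ip n (R a) y = t * x a" "\<And>b. b < n \<Longrightarrow> ip m x (\<lambda>a. R a b) = t * y b"
    "\<And>x' y'. ip m x' x' = 1 \<Longrightarrow> ip n y' y' = 1 \<Longrightarrow> bil m n R x' y' \<le> t"
proof -
  obtain x y where x: "ip m x x = 1" and y: "ip n y y = 1"
    and max: "\<And>x' y'. ip m x' x' = 1 \<Longrightarrow> ip n y' y' = 1 \<Longrightarrow> bil m n R x' y' \<le> bil m n R x y"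
    using bil_attains_max[of m n R] j by (metis less_nat_zero_code not_gr_zero)
  define t where "t = bil m n R x y"
  have Ry: "ip n (R a) y = t * x a" if "a < m" for a
    using maximal_ip_imp_parallel[OF x _ that, of "\<lambda>a. ip n (R a) y"] max[OF _ y]
    unfolding t_def bil_def by blast
  have Rx: "ip m x (\<lambda>a. R a b) = t * y b" if "b < n" for b
    using maximal_ip_imp_parallel[OF y _ that, of "\<lambda>b. ip m x (\<lambda>a. R a b)"] max[OF x]
    unfolding t_def bil_transpose ip_commute[of n _ "\<lambda>b. ip m x (\<lambda>a. R a b)"] by blast
  have neg: "bil m n R (\<lambda>a. -1 * x' a) y' = - bil m n R x' y'" for x' y'
    unfolding bil_def ip_scale_left by simp
  have negu: "ip m (\<lambda>a. -1 * x' a) (\<lambda>a. -1 * x' a) = ip m x' x'" for x'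
    unfolding ip_scale_left ip_scale_right by simp
  \<comment> \<open>Negating \<open>x\<close> keeps its length and flips the sign of the
    form.\<close>
  have t0: "0 \<le> t"
    using max[of "\<lambda>a. -1 * x a" y] x y unfolding negu neg t_def by simp
  show thesis
  proof (cases "t = 0")
    case True
    have R0: "R a b = 0" if "a < m" "b < n" for a b
    proof -
      have "R a b \<le> 0"
        using max[of "coord a" "coord b"] that True by (simp add: ip_coord_self bil_coord t_def)
      moreover have "- R a b \<le> 0"
        using max[of "\<lambda>c. -1 * coord a c" "coord b"] that True
        unfolding negu neg by (simp add: ip_coord_self bil_coord t_def)
      ultimately show ?thesis by simp
    qed
    obtain x' where x': "ip m x' x' = 1" "\<And>i. i < j \<Longrightarrow> ip m (p i) x' = 0"
      using orthonormal_extend[OF p j(1)] by blast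
    obtain y' where y': "ip n y' y' = 1" "\<And>i. i < j \<Longrightarrow> ip n (q i) y' = 0"
      using orthonormal_extend[OF q j(2)] by blast
    show thesis
      by (rule that[of x' y' 0]) (use x' y' R0 in \<open>auto simp: bil_def ip_def\<close>)
  next
    case False
    have px: "ip m (p i) x = 0" if "i < j" for i
    proof -
      have "t * ip m (p i) x = ip m (p i) (\<lambda>a. ip n (R a) y)"
        unfolding ip_scale_right[symmetric] by (rule ip_cong) (simp_all add: Ry)
      also have "\<dots> = ip n (\<lambda>b. ip m (p i) (\<lambda>a. R a b)) y"
        using bil_transpose by (simp add: bil_def)
      also have "\<dots> = 0" using Rp[OF that] by (simp add: ip_def[of n])
      finally show ?thesis using False by simp
    qed
    have qy: "ip n (q i) y = 0" if "i < j" for i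
    proof -
      have "t * ip n (q i) y = ip n (\<lambda>b. ip m x (\<lambda>a. R a b)) (q i)"
        unfolding ip_commute[of n "q i"] ip_scale_left[symmetric] by (rule ip_cong) (simp_all add: Rx)
      also have "\<dots> = ip m x (\<lambda>a. ip n (R a) (q i))"
        using bil_transpose by (simp add: bil_def)
      also have "\<dots> = 0" using Rq[OF that] by (simp add: ip_def[of m])
      finally show ?thesis using False by simp
    qed
    show thesis
      by (rule that[of x y t]) (use x y t0 Rx Ry px qy max in \<open>auto simp: t_def\<close>)
  qed
qed

text \<open>
  The residual \<open>R\<close> is compared with \<open>s i\<close> only along vectors orthogonal to all earlier \<open>p l\<close>: there the
  deflated residual agrees with the previous one, and a maximizer with positive value is orthogonal
  to them anyway.
\<close>

definition partial_svd ::
  "nat \<Rightarrow> nat \<Rightarrow> nat \<Rightarrow> (nat \<Rightarrow> nat \<Rightarrow> real) \<Rightarrow> (nat \<Rightarrow> nat \<Rightarrow> real) \<Rightarrow> (nat \<Rightarrow> real) \<Rightarrow> (nat \<Rightarrow> nat \<Rightarrow> real)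
    \<Rightarrow> (nat \<Rightarrow> nat \<Rightarrow> real) \<Rightarrow> bool" where
  "partial_svd m n j W p s q R \<longleftrightarrow>
     orthonormal m j p \<and> orthonormal n j q \<and>
     (\<forall>i<j. 0 \<le> s i) \<and> (\<forall>i l. i \<le> l \<and> l < j \<longrightarrow> s l \<le> s i) \<and>
     (\<forall>a b. W a b = R a b + (\<Sum>i<j. s i * p i a * q i b)) \<and>
     (\<forall>i<j. \<forall>a<m. ip n (R a) (q i) = 0) \<and>
     (\<forall>i<j. \<forall>b<n. ip m (p i) (\<lambda>a. R a b) = 0) \<and>
     (\<forall>i<j. \<forall>x y. ip m x x = 1 \<longrightarrow> ip n y y = 1 \<longrightarrow> (\<forall>l<j. ip m (p l) x = 0) \<longrightarrow> bil m n R x y \<le> s i)"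

lemma orthonormal_Suc:
  assumes "orthonormal m j p" "ip m x x = 1" "\<And>i. i < j \<Longrightarrow> ip m (p i) x = 0"
  shows "orthonormal m (Suc j) (p(j := x))"
proof -
  have "ip m x (p i) = 0" if "i < j" for i
    using assms(3)[OF that] by (simp add: ip_commute)
  then show ?thesis
    using assms by (auto simp: orthonormal_def less_Suc_eq)
qed

lemma exists_partial_svd:
  assumes "j \<le> m" "j \<le> n"
  shows "\<exists>p s q R. partial_svd m n j W p s q R"
  using assms
proof (induction j)
  case 0
  have "partial_svd m n 0 W (\<lambda>_ _. 0) (\<lambda>_. 0) (\<lambda>_ _. 0) W"
    by (simp add: partial_svd_def orthonormal_def)
  then show ?case by blast
next
  case (Suc j)
  then obtain p s q R where IH: "partial_svd m n j W p s q R" by auto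
  have p: "orthonormal m j p" and q: "orthonormal n j q" and s0: "\<And>i. i < j \<Longrightarrow> 0 \<le> s i"
    and dec: "\<And>i l. i \<le> l \<Longrightarrow> l < j \<Longrightarrow> s l \<le> s i"
    and W: "\<And>a b. W a b = R a b + (\<Sum>i<j. s i * p i a * q i b)"
    and Rq: "\<And>i a. i < j \<Longrightarrow> a < m \<Longrightarrow> ip n (R a) (q i) = 0"
    and Rp: "\<And>i b. i < j \<Longrightarrow> b < n \<Longrightarrow> ip m (p i) (\<lambda>a. R a b) = 0"
    and bd: "\<And>i x y. i < j \<Longrightarrow> ip m x x = 1 \<Longrightarrow> ip n y y = 1 \<Longrightarrow> (\<forall>l<j. ip m (p l) x = 0)
      \<Longrightarrow> bil m n R x y \<le> s i"
    using IH by (simp_all add: partial_svd_def)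
  have j: "j < m" "j < n" using Suc.prems by auto
  obtain x y t where x: "ip m x x = 1" and y: "ip n y y = 1" and t: "0 \<le> t"
    and px: "\<And>i. i < j \<Longrightarrow> ip m (p i) x = 0" and qy: "\<And>i. i < j \<Longrightarrow> ip n (q i) y = 0"
    and Ry: "\<And>a. a < m \<Longrightarrow> ip n (R a) y = t * x a"
    and Rx: "\<And>b. b < n \<Longrightarrow> ip m x (\<lambda>a. R a b) = t * y b"
    and max: "\<And>x' y'. ip m x' x' = 1 \<Longrightarrow> ip n y' y' = 1 \<Longrightarrow> bil m n R x' y' \<le> t"
    using exists_singular_pair[OF p q j Rq Rp] by blast
  have "bil m n R x y = ip m x (\<lambda>a. t * x a)"
    unfolding bil_def by (rule ip_cong) (simp_all add: Ry)
  then have "bil m n R x y = t" by (simp add: ip_scale_right x)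
  \<comment> \<open>The new pair is an admissible test pair for the bound on the old residual; this
    is what keeps the singular values nonincreasing.\<close>
  then have ts: "t \<le> s i" if "i < j" for i
    using bd[OF that x y] px by simp
  define R' where "R' = (\<lambda>a b. R a b - (t * x a) * y b)"
  define p' where "p' = p(j := x)"
  define q' where "q' = q(j := y)"
  define s' where "s' = s(j := t)"
  have "W a b = R' a b + (\<Sum>i<Suc j. s' i * p' i a * q' i b)" for a b
    by (simp add: W R'_def p'_def q'_def s'_def)
  moreover have "ip n (R' a) (q' i) = 0" if "i < Suc j" "a < m" for i a
    using that Rq[of i a] Ry[of a] qy[of i]
    by (auto simp: R'_def q'_def ip_diff_left ip_scale_left ip_commute[of n y "q i"] y less_Suc_eq)
  moreover have "ip m (p' i) (\<lambda>a. R' a b) = 0" if "i < Suc j" "b < n" for i b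
  proof -
    have "(\<lambda>a. R' a b) = (\<lambda>a. R a b - (t * y b) * x a)" by (simp add: R'_def mult_ac)
    then have "ip m (p' i) (\<lambda>a. R' a b) = ip m (p' i) (\<lambda>a. R a b) - (t * y b) * ip m (p' i) x"
      by (simp only: ip_diff_right ip_scale_right)
    then show ?thesis
      using that Rp[of i b] Rx[of b] px[of i] by (auto simp: p'_def x less_Suc_eq)
  qed
  moreover have "bil m n R' x' y' \<le> s' i"
    if "i < Suc j" "ip m x' x' = 1" "ip n y' y' = 1" "\<forall>l<Suc j. ip m (p' l) x' = 0" for i x' y'
  proof -
    have "ip m x x' = 0" using that(4) by (auto simp: p'_def)
    \<comment> \<open>The subtracted rank-one part enters only through \<open>ip m x' x\<close>,
      which vanishes, so the old maximum \<open>t\<close> still bounds the form.\<close>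
    moreover have "bil m n R' x' y' = bil m n R x' y' - ip n y y' * t * ip m x' x"
    proof -
      have "(\<lambda>a. ip n (R' a) y') = (\<lambda>a. ip n (R a) y' - (ip n y y' * t) * x a)"
        by (simp add: R'_def ip_diff_left ip_scale_left mult_ac)
      then show ?thesis by (simp only: bil_def ip_diff_right ip_scale_right)
    qed
    ultimately have "bil m n R' x' y' \<le> t"
      using max[OF that(2,3)] by (simp add: ip_commute[of m x' x])
    also have "t \<le> s' i" using that(1) ts by (auto simp: s'_def less_Suc_eq)
    finally show ?thesis .
  qed
  moreover have "orthonormal m (Suc j) p'" "orthonormal n (Suc j) q'"
    unfolding p'_def q'_def by (rule orthonormal_Suc[OF p x px] orthonormal_Suc[OF q y qy]; assumption)+
  moreover have "0 \<le> s' i" if "i < Suc j" for i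
    using that s0 t by (auto simp: s'_def less_Suc_eq)
  moreover have "s' l \<le> s' i" if "i \<le> l" "l < Suc j" for i l
    using that dec ts by (auto simp: s'_def less_Suc_eq)
  ultimately have "partial_svd m n (Suc j) W p' s' q' R'"
    unfolding partial_svd_def by (intro conjI allI impI) simp_all
  then show ?case by blast
qed

text \<open>Counterpart of \<open>is_svd\<close> for entry functions: only the entries inside the m
  by n block are constrained, and the vectors are indexed by column.\<close>

definition svd_form ::
  "nat \<Rightarrow> nat \<Rightarrow> nat \<Rightarrow> (nat \<Rightarrow> nat \<Rightarrow> real) \<Rightarrow> (nat \<Rightarrow> nat \<Rightarrow> real) \<Rightarrow> (nat \<Rightarrow> real) \<Rightarrow> (nat \<Rightarrow> nat \<Rightarrow> real) \<Rightarrow> bool" where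
  "svd_form m n k W p s q \<longleftrightarrow>
     orthonormal m k p \<and> orthonormal n k q \<and>
     (\<forall>i<k. 0 \<le> s i) \<and> (\<forall>i j. i \<le> j \<and> j < k \<longrightarrow> s j \<le> s i) \<and>
     (\<forall>a<m. \<forall>b<n. W a b = (\<Sum>i<k. s i * p i a * q i b))"

lemma eq_0_if_orthogonal_to_basis:
  assumes "orthonormal n n q" "\<And>i. i < n \<Longrightarrow> ip n w (q i) = 0" "b < n"
  shows "w b = 0"
proof -
  have "w b = (\<Sum>c<n. w c * (if c = b then 1 else 0))"
    using assms(3) by (simp add: if_distrib[of "(*) _"] cong: if_cong)
  also have "\<dots> = (\<Sum>c<n. w c * (\<Sum>i<n. q i c * q i b))"
    using assms(3) by (intro sum.cong) (simp_all add: orthonormal_complete[OF assms(1)])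
  also have "\<dots> = (\<Sum>i<n. ip n w (q i) * q i b)"
    unfolding ip_def sum_distrib_left sum_distrib_right
    by (subst sum.swap) (simp add: mult_ac)
  also have "\<dots> = 0" using assms(2) by simp
  finally show ?thesis .
qed

text \<open>After \<open>min m n\<close> deflations one of the two systems is a full orthonormal
  basis. It is orthogonal to all columns of the residual if \<open>m \<le> n\<close>, and to all
  rows otherwise, so the residual vanishes.\<close>

theorem exists_svd_form: "\<exists>p s q. svd_form m n (min m n) W p s q"
proof -
  obtain p s q R where *: "partial_svd m n (min m n) W p s q R"
    using exists_partial_svd[of "min m n" m n W] by auto
  have "R a b = 0" if "a < m" "b < n" for a b
  proof (cases "m \<le> n")
    case True
    then show ?thesis
      using * that eq_0_if_orthogonal_to_basis[of m p "\<lambda>a. R a b" a]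
      by (simp add: partial_svd_def ip_commute[of m "\<lambda>a. R a b"])
  next
    case False
    then show ?thesis
      using * that eq_0_if_orthogonal_to_basis[of n q "R a" b] by (simp add: partial_svd_def min_def)
  qed
  then have "svd_form m n (min m n) W p s q"
    using * by (simp add: partial_svd_def svd_form_def)
  then show ?thesis by blast
qed

section \<open>Duality between the nuclear norm and contractions\<close>

text \<open>The Frobenius inner product, the trace of the product of the transpose of
  \<open>A\<close> with \<open>B\<close>.\<close>

definition fip :: "nat \<Rightarrow> nat \<Rightarrow> (nat \<Rightarrow> nat \<Rightarrow> real) \<Rightarrow> (nat \<Rightarrow> nat \<Rightarrow> real) \<Rightarrow> real" where
  "fip m n A B = (\<Sum>a<m. ip n (A a) (B a))"

text \<open>Operator norm at most \<open>c\<close>, expressed by the bilinear form with vectors of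
  any length, so that columns of factors can be inserted without normalization.\<close>

definition contraction :: "nat \<Rightarrow> nat \<Rightarrow> real \<Rightarrow> (nat \<Rightarrow> nat \<Rightarrow> real) \<Rightarrow> bool" where
  "contraction m n c Y \<longleftrightarrow> (\<forall>x y. bil m n Y x y \<le> c * (L2_set x {..<m} * L2_set y {..<n}))"

lemma fip_cong:
  "(\<And>a b. a < m \<Longrightarrow> b < n \<Longrightarrow> A a b = A' a b) \<Longrightarrow> (\<And>a b. a < m \<Longrightarrow> b < n \<Longrightarrow> B a b = B' a b)
    \<Longrightarrow> fip m n A B = fip m n A' B'"
  by (simp add: fip_def ip_def)

lemma fip_commute: "fip m n A B = fip m n B A"
  by (simp add: fip_def ip_commute)

lemma fip_diff_right: "fip m n A (\<lambda>a b. B a b - C a b) = fip m n A B - fip m n A C"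
  by (simp add: fip_def ip_diff_right sum_subtractf)

lemma fip_diff_left: "fip m n (\<lambda>a b. B a b - C a b) A = fip m n B A - fip m n C A"
  by (simp add: fip_def ip_diff_left sum_subtractf)

lemma fip_self_nonneg: "0 \<le> fip m n A A"
  by (simp add: fip_def ip_self_nonneg sum_nonneg)

lemma fip_self_eq_0_D:
  assumes "fip m n A A \<le> 0" "a < m" "b < n"
  shows "A a b = 0"
proof -
  have "ip n (A a) (A a) \<le> fip m n A A"
    unfolding fip_def by (rule member_le_sum) (use assms in \<open>auto simp: ip_self_nonneg\<close>)
  then show ?thesis using assms ip_self_eq_0_D[of n "A a" b] by simp
qed

lemma fip_sum_rank_one:
  "fip m n Y (\<lambda>a b. \<Sum>i\<in>I. s i * p i a * q i b) = (\<Sum>i\<in>I. s i * bil m n Y (p i) (q i))"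
proof -
  have "fip m n Y (\<lambda>a b. \<Sum>i\<in>I. s i * p i a * q i b) = (\<Sum>a<m. \<Sum>i\<in>I. s i * (p i a * ip n (Y a) (q i)))"
    unfolding fip_def ip_sum_right ip_scale_right by (simp add: mult_ac)
  also have "\<dots> = (\<Sum>i\<in>I. \<Sum>a<m. s i * (p i a * ip n (Y a) (q i)))" by (rule sum.swap)
  finally show ?thesis by (simp add: bil_def ip_def[of m] sum_distrib_left)
qed

lemma orthonormal_L2_set: "orthonormal m k p \<Longrightarrow> i < k \<Longrightarrow> L2_set (p i) {..<m} = 1"
  by (simp add: L2_set_eq_sqrt_ip orthonormal_def)

text \<open>Each \<open>y i\<close> is replaced by \<open>c\<close>; Cauchy-Schwarz then applies to
  the two coefficient sequences, whose lengths are controlled by Bessel.\<close>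

lemma contraction_sum_rank_one:
  assumes p: "orthonormal m k p" and q: "orthonormal n k q"
    and y: "\<And>i. i < k \<Longrightarrow> 0 \<le> y i" "\<And>i. i < k \<Longrightarrow> y i \<le> c" and c: "0 \<le> c"
  shows "contraction m n c (\<lambda>a b. \<Sum>i<k. y i * p i a * q i b)"
  unfolding contraction_def
proof (intro allI)
  fix x z
  let ?f = "\<lambda>i. ip m (p i) x" and ?g = "\<lambda>i. ip n (q i) z"
  have b1: "L2_set ?f {..<k} \<le> L2_set x {..<m}"
    using bessel[OF p, of x] unfolding L2_set_eq_sqrt_ip[of x] by (simp add: L2_set_def)
  have b2: "L2_set ?g {..<k} \<le> L2_set z {..<n}"
    using bessel[OF q, of z] unfolding L2_set_eq_sqrt_ip[of z] by (simp add: L2_set_def)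
  have "bil m n (\<lambda>a b. \<Sum>i<k. y i * p i a * q i b) x z = (\<Sum>i<k. y i * (?f i * ?g i))"
    unfolding bil_sum_rank_one by (simp add: ip_commute mult.assoc)
  also have "\<dots> \<le> (\<Sum>i<k. c * (\<bar>?f i\<bar> * \<bar>?g i\<bar>))"
  proof (rule sum_mono)
    fix i assume "i \<in> {..<k}"
    then have "y i * (?f i * ?g i) \<le> y i * (\<bar>?f i\<bar> * \<bar>?g i\<bar>)"
      using y by (intro mult_left_mono) (auto simp: abs_mult[symmetric])
    also have "\<dots> \<le> c * (\<bar>?f i\<bar> * \<bar>?g i\<bar>)"
      using y \<open>i \<in> {..<k}\<close> by (intro mult_right_mono) auto
    finally show "y i * (?f i * ?g i) \<le> c * (\<bar>?f i\<bar> * \<bar>?g i\<bar>)" .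
  qed
  also have "\<dots> = c * (\<Sum>i<k. \<bar>?f i\<bar> * \<bar>?g i\<bar>)" by (simp add: sum_distrib_left)
  also have "\<dots> \<le> c * (L2_set ?f {..<k} * L2_set ?g {..<k})"
    by (intro mult_left_mono L2_set_mult_ineq c)
  also have "\<dots> \<le> c * (L2_set x {..<m} * L2_set z {..<n})"
    by (intro mult_left_mono mult_mono b1 b2 c) simp_all
  finally show "bil m n (\<lambda>a b. \<Sum>i<k. y i * p i a * q i b) x z \<le> c * (L2_set x {..<m} * L2_set z {..<n})" .
qed

text \<open>The vectors are arbitrary, so this serves both the singular vectors of a matrix and the
  columns of a factorization.\<close>

lemma fip_contraction_sum_rank_one_le:
  assumes "contraction m n c Y" "\<And>i. i \<in> I \<Longrightarrow> 0 \<le> s i"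
  shows "fip m n Y (\<lambda>a b. \<Sum>i\<in>I. s i * p i a * q i b)
    \<le> c * (\<Sum>i\<in>I. s i * (L2_set (p i) {..<m} * L2_set (q i) {..<n}))"
proof -
  have "fip m n Y (\<lambda>a b. \<Sum>i\<in>I. s i * p i a * q i b)
      \<le> (\<Sum>i\<in>I. s i * (c * (L2_set (p i) {..<m} * L2_set (q i) {..<n})))"
    unfolding fip_sum_rank_one
    using assms by (intro sum_mono mult_left_mono) (auto simp: contraction_def)
  then show ?thesis by (simp add: sum_distrib_left mult_ac)
qed

lemma svd_form_fip_le:
  assumes "svd_form m n k W p s q" "contraction m n c Y"
  shows "fip m n Y W \<le> c * (\<Sum>i<k. s i)"
proof -
  have W: "fip m n Y W = fip m n Y (\<lambda>a b. \<Sum>i<k. s i * p i a * q i b)"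
    using assms(1) by (intro fip_cong) (auto simp: svd_form_def)
  have "(\<Sum>i<k. s i * (L2_set (p i) {..<m} * L2_set (q i) {..<n})) = (\<Sum>i<k. s i)"
    using assms(1) by (intro sum.cong) (auto simp: svd_form_def orthonormal_L2_set)
  then show ?thesis
    using fip_contraction_sum_rank_one_le[OF assms(2), of "{..<k}" s p q] assms(1)
    unfolding W by (simp add: svd_form_def)
qed

lemma bil_sum_rank_one_diag:
  assumes "orthonormal m k p" "orthonormal n k q" "l < k"
  shows "bil m n (\<lambda>a b. \<Sum>i<k. y i * p i a * q i b) (p l) (q l) = y l"
proof -
  have "bil m n (\<lambda>a b. \<Sum>i<k. y i * p i a * q i b) (p l) (q l)
      = (\<Sum>i<k. y i * ip m (p l) (p i) * ip n (q i) (q l))"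
    by (rule bil_sum_rank_one)
  also have "\<dots> = (\<Sum>i<k. if i = l then y i else 0)"
    using assms by (intro sum.cong) (auto simp: orthonormal_def)
  finally show ?thesis using assms(3) by simp
qed

lemma svd_form_bil_diag:
  assumes "svd_form m n k W p s q" "l < k"
  shows "bil m n W (p l) (q l) = s l"
proof -
  have "bil m n W (p l) (q l) = bil m n (\<lambda>a b. \<Sum>i<k. s i * p i a * q i b) (p l) (q l)"
    using assms(1) by (intro bil_cong) (simp add: svd_form_def)
  then show ?thesis
    using bil_sum_rank_one_diag[of m k p n q l s] assms by (simp add: svd_form_def)
qed

text \<open>The partial isometry \<open>?Y\<close> built from the first decomposition is a
  contraction and pairs with \<open>W\<close> to the first sum; duality bounds this pairing by the
  second sum. Used in both directions, this shows that the sum depends only on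
  \<open>W\<close>.\<close>

lemma svd_form_sum_le:
  assumes "svd_form m n k W p s q" "svd_form m n k' W p' s' q'"
  shows "(\<Sum>i<k. s i) \<le> (\<Sum>i<k'. s' i)"
proof -
  let ?Y = "\<lambda>a b. \<Sum>i<k. 1 * p i a * q i b"
  have pq: "orthonormal m k p" "orthonormal n k q" using assms(1) by (auto simp: svd_form_def)
  have "fip m n ?Y W = fip m n ?Y (\<lambda>a b. \<Sum>i<k. s i * p i a * q i b)"
    using assms(1) by (intro fip_cong) (auto simp: svd_form_def)
  also have "\<dots> = (\<Sum>i<k. s i * bil m n ?Y (p i) (q i))" by (rule fip_sum_rank_one)
  also have "\<dots> = (\<Sum>i<k. s i)"
    using bil_sum_rank_one_diag[OF pq, of _ "\<lambda>_. 1"] by (intro sum.cong) auto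
  finally show ?thesis
    using svd_form_fip_le[OF assms(2) contraction_sum_rank_one[OF pq, of "\<lambda>_. 1" 1]] by simp
qed

text \<open>Expanding around \<open>W0\<close> leaves a linear term, which the two hypotheses bound,
  and the square of \<open>W - W0\<close>. The number \<open>N\<close> is the nuclear norm of
  \<open>W\<close> or, for a factorization, the sum of the products of column lengths, so one
  inequality serves both objectives.\<close>

lemma fip_quadratic_lower_bound:
  fixes \<tau> N :: real
  assumes "0 < k" and W0: "fip m n (\<lambda>a b. 2 * M a b - W0 a b) W0 = \<tau> * (real k * \<tau>)"
    and W: "fip m n (\<lambda>a b. 2 * M a b - W0 a b) W \<le> \<tau> * N"
  shows "1/4 * fip m n (\<lambda>a b. W0 a b - 2 * M a b) (\<lambda>a b. W0 a b - 2 * M a b) + 1 / (4 * real k) * (real k * \<tau>)\<^sup>2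
      + 1/4 * fip m n (\<lambda>a b. W a b - W0 a b) (\<lambda>a b. W a b - W0 a b)
    \<le> 1/4 * fip m n (\<lambda>a b. W a b - 2 * M a b) (\<lambda>a b. W a b - 2 * M a b) + 1 / (4 * real k) * N\<^sup>2"
proof -
  define D where "D = (\<lambda>a b. 2 * M a b)"
  have *: "fip m n W0 D = fip m n D W0" "fip m n W D = fip m n D W" "fip m n W W0 = fip m n W0 W"
    by (simp_all add: fip_commute)
  have 0: "fip m n D W0 - fip m n W0 W0 = \<tau> * (real k * \<tau>)"
    and 1: "fip m n D W - fip m n W0 W \<le> \<tau> * N"
    using W0 W unfolding D_def[symmetric] fip_diff_left by (simp_all add: D_def)
  \<comment> \<open>This replaces the square of \<open>N\<close> by its tangent at
    \<open>k \<tau>\<close>, the value at the minimizer.\<close>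
  have "0 \<le> (N - real k * \<tau>)\<^sup>2 / (4 * real k)" by simp
  also have "\<dots> = 1 / (4 * real k) * N\<^sup>2 - 1/2 * (\<tau> * N) + 1/4 * (\<tau> * (real k * \<tau>))"
    using assms(1) by (simp add: field_simps power2_eq_square)
  also have "1/4 * (\<tau> * (real k * \<tau>)) = 1/2 * (\<tau> * (real k * \<tau>)) - 1 / (4 * real k) * (real k * \<tau>)\<^sup>2"
    using assms(1) by (simp add: field_simps power2_eq_square)
  finally have "1/2 * (\<tau> * N) - 1/2 * (\<tau> * (real k * \<tau>)) + 1 / (4 * real k) * (real k * \<tau>)\<^sup>2
      \<le> 1 / (4 * real k) * N\<^sup>2" by simp
  moreover have "fip m n (\<lambda>a b. W a b - D a b) (\<lambda>a b. W a b - D a b)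
      = fip m n (\<lambda>a b. W0 a b - D a b) (\<lambda>a b. W0 a b - D a b) + fip m n (\<lambda>a b. W a b - W0 a b) (\<lambda>a b. W a b - W0 a b)
       - 2 * (fip m n D W - fip m n W0 W) + 2 * (fip m n D W0 - fip m n W0 W0)"
    by (simp add: fip_diff_left fip_diff_right *)
  moreover have "1/4 * A0 + E0 + 1/4 * B \<le> 1/4 * A + E"
    if "1/2 * u - 1/2 * v + E0 \<le> E" "A = A0 + B - 2 * z + 2 * z0" "z0 = v" "z \<le> u"
    for A A0 B E E0 u v z z0 :: real
    using that by linarith
  ultimately show ?thesis
    using 0 1 unfolding D_def by blast
qed

section \<open>Matrices\<close>

definition entries :: "real mat \<Rightarrow> nat \<Rightarrow> nat \<Rightarrow> real" where
  "entries A = (\<lambda>a b. A $$ (a, b))"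

definition columns :: "real mat \<Rightarrow> nat \<Rightarrow> nat \<Rightarrow> real" where
  "columns A = (\<lambda>i a. A $$ (a, i))"

lemma frob_norm_power2:
  assumes "A \<in> carrier_mat m n"
  shows "(frob_norm A)\<^sup>2 = fip m n (entries A) (entries A)"
proof -
  have "0 \<le> (\<Sum>i<m. \<Sum>j<n. (A $$ (i, j))\<^sup>2)" by (intro sum_nonneg) simp
  then show ?thesis
    using assms by (simp add: frob_norm_def fip_def ip_def entries_def power2_eq_square[of "A $$ _"])
qed

lemma frob_norm_diff_power2:
  assumes "A \<in> carrier_mat m n" "B \<in> carrier_mat m n"
  shows "(frob_norm (A - B))\<^sup>2
    = fip m n (\<lambda>a b. entries A a b - entries B a b) (\<lambda>a b. entries A a b - entries B a b)"
proof -
  have "A - B \<in> carrier_mat m n" using assms by (simp add: minus_carrier_mat)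
  then have "(frob_norm (A - B))\<^sup>2 = fip m n (entries (A - B)) (entries (A - B))"
    by (rule frob_norm_power2)
  also have "\<dots> = fip m n (\<lambda>a b. entries A a b - entries B a b) (\<lambda>a b. entries A a b - entries B a b)"
    using assms by (intro fip_cong) (auto simp: entries_def)
  finally show ?thesis .
qed

lemma entries_mult_diag_transpose:
  assumes "P \<in> carrier_mat m k" "Q \<in> carrier_mat n k" "a < m" "b < n"
  shows "entries (P * diag_k k s * transpose_mat Q) a b = (\<Sum>i<k. s i * columns P i a * columns Q i b)"
proof -
  have "(P * diag_k k s) $$ (a, i) = s i * P $$ (a, i)" if "i < k" for i
  proof -
    have "(P * diag_k k s) $$ (a, i) = (\<Sum>l\<in>{0..<k}. P $$ (a, l) * (if l = i then s l else 0))"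
      using assms that by (simp add: scalar_prod_def diag_k_def)
    also have "\<dots> = (\<Sum>l\<in>{0..<k}. if l = i then P $$ (a, l) * s l else 0)"
      by (intro sum.cong) auto
    finally show ?thesis using that by simp
  qed
  moreover have "entries (P * diag_k k s * transpose_mat Q) a b
      = (\<Sum>i\<in>{0..<k}. (P * diag_k k s) $$ (a, i) * Q $$ (b, i))"
    using assms by (simp add: entries_def scalar_prod_def diag_k_def del: index_mult_mat(1))
      (simp add: scalar_prod_def)
  ultimately show ?thesis by (simp add: columns_def atLeast0LessThan)
qed

lemma entries_mult_transpose:
  assumes "P \<in> carrier_mat m k" "Q \<in> carrier_mat n k" "a < m" "b < n"
  shows "entries (P * transpose_mat Q) a b = (\<Sum>i<k. 1 * columns P i a * columns Q i b)"
  using assms by (simp add: entries_def scalar_prod_def columns_def atLeast0LessThan)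

lemma transpose_mult_eq_one_iff:
  assumes "P \<in> carrier_mat m k"
  shows "transpose_mat P * P = 1\<^sub>m k \<longleftrightarrow> orthonormal m k (columns P)"
proof -
  have "transpose_mat P * P = 1\<^sub>m k \<longleftrightarrow>
      (\<forall>i<k. \<forall>j<k. (transpose_mat P * P) $$ (i, j) = 1\<^sub>m k $$ (i, j))"
    using assms by (auto simp del: index_mult_mat(1) index_one_mat(1))
  also have "\<dots> \<longleftrightarrow> orthonormal m k (columns P)"
    unfolding orthonormal_def
    using assms by (simp add: scalar_prod_def ip_def columns_def atLeast0LessThan)
  finally show ?thesis .
qed

lemma is_svd_iff_svd_form:
  assumes "W \<in> carrier_mat m n" "P \<in> carrier_mat m (min m n)" "Q \<in> carrier_mat n (min m n)"
  shows "is_svd W P s Q \<longleftrightarrow> svd_form m n (min m n) (entries W) (columns P) s (columns Q)"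
proof -
  let ?k = "min m n"
  have "W = P * diag_k ?k s * transpose_mat Q \<longleftrightarrow>
      (\<forall>a<m. \<forall>b<n. W $$ (a, b) = (P * diag_k ?k s * transpose_mat Q) $$ (a, b))"
    using assms by (auto simp del: index_mult_mat(1))
  also have "\<dots> \<longleftrightarrow> (\<forall>a<m. \<forall>b<n. entries W a b = (\<Sum>i<?k. s i * columns P i a * columns Q i b))"
    using entries_mult_diag_transpose[OF assms(2,3), of _ _ s] by (simp add: entries_def)
  finally show ?thesis
    using assms transpose_mult_eq_one_iff[OF assms(2)] transpose_mult_eq_one_iff[OF assms(3)]
    by (simp add: is_svd_def svd_form_def Let_def)
qed

section \<open>Singular value decomposition and nuclear norm of matrices\<close>

lemma is_svd_carrier:
  assumes "is_svd W P s Q" "W \<in> carrier_mat m n"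
  shows "P \<in> carrier_mat m (min m n)" "Q \<in> carrier_mat n (min m n)"
  using assms by (auto simp: is_svd_def Let_def)

lemma exists_svd:
  assumes "W \<in> carrier_mat m n"
  shows "\<exists>P s Q. is_svd W P s Q"
proof -
  let ?k = "min m n"
  obtain p s q where pq: "svd_form m n ?k (entries W) p s q"
    using exists_svd_form by blast
  define P where "P = mat m ?k (\<lambda>(a, i). p i a)"
  define Q where "Q = mat n ?k (\<lambda>(b, i). q i b)"
  have "svd_form m n ?k (entries W) (columns P) s (columns Q)"
    using pq by (simp add: svd_form_def orthonormal_def ip_def columns_def P_def Q_def)
  then show ?thesis
    using is_svd_iff_svd_form[OF assms, of P Q s] by (auto simp: P_def Q_def)
qed

text \<open>The definite description is legitimate because \<open>svd_form_sum_le\<close> compares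
  any two decompositions in both directions.\<close>

lemma nuc_norm_eq:
  assumes "is_svd W P s Q" "W \<in> carrier_mat m n"
  shows "nuc_norm W = (\<Sum>i<min m n. s i)"
  unfolding nuc_norm_def
proof (rule the_equality)
  show "\<exists>P' s' Q'. is_svd W P' s' Q' \<and> (\<Sum>i<min m n. s i) = (\<Sum>i<min (dim_row W) (dim_col W). s' i)"
    using assms by auto
  fix t assume "\<exists>P' s' Q'. is_svd W P' s' Q' \<and> t = (\<Sum>i<min (dim_row W) (dim_col W). s' i)"
  then obtain P' s' Q' where *: "is_svd W P' s' Q'" "t = (\<Sum>i<min m n. s' i)"
    using assms(2) by auto
  have "svd_form m n (min m n) (entries W) (columns P) s (columns Q)"
    using assms is_svd_iff_svd_form[OF assms(2) is_svd_carrier[OF assms]] by blast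
  moreover have "svd_form m n (min m n) (entries W) (columns P') s' (columns Q')"
    using *(1) is_svd_iff_svd_form[OF assms(2) is_svd_carrier[OF *(1) assms(2)]] by blast
  ultimately show "t = (\<Sum>i<min m n. s i)"
    using svd_form_sum_le *(2) by (intro antisym) blast+
qed

lemma fip_le_nuc_norm:
  assumes "W \<in> carrier_mat m n" "contraction m n c Y"
  shows "fip m n Y (entries W) \<le> c * nuc_norm W"
proof -
  obtain P s Q where *: "is_svd W P s Q" using exists_svd[OF assms(1)] by blast
  then have "svd_form m n (min m n) (entries W) (columns P) s (columns Q)"
    using is_svd_iff_svd_form[OF assms(1) is_svd_carrier[OF * assms(1)]] by blast
  from svd_form_fip_le[OF this assms(2)] show ?thesis using nuc_norm_eq[OF * assms(1)] by simp
qed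

lemma Phi_eq:
  assumes "M \<in> carrier_mat m n" "W \<in> carrier_mat m n"
  shows "Phi k M W = 1/4 * fip m n (\<lambda>a b. entries W a b - 2 * entries M a b) (\<lambda>a b. entries W a b - 2 * entries M a b)
    + 1 / (4 * real k) * (nuc_norm W)\<^sup>2"
proof -
  have "2 \<cdot>\<^sub>m M \<in> carrier_mat m n" using assms by simp
  from frob_norm_diff_power2[OF assms(2) this]
  have "(frob_norm (W - 2 \<cdot>\<^sub>m M))\<^sup>2 = fip m n (\<lambda>a b. entries W a b - entries (2 \<cdot>\<^sub>m M) a b) (\<lambda>a b. entries W a b - entries (2 \<cdot>\<^sub>m M) a b)" .
  also have "\<dots> = fip m n (\<lambda>a b. entries W a b - 2 * entries M a b) (\<lambda>a b. entries W a b - 2 * entries M a b)"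
    using assms by (intro fip_cong) (auto simp: entries_def)
  finally show ?thesis by (simp add: Phi_def)
qed

section \<open>The dropout loss\<close>

text \<open>This is the second moment of a random subset sum: including each element with
  probability 1/2 gives mean \<open>sum x K / 2\<close> and variance one quarter of the sum of
  squares. In the induction, subsets containing \<open>a\<close> amount to shifting \<open>t\<close>
  by \<open>x a\<close>, hence the general \<open>t\<close>.\<close>

lemma sum_Pow_square:
  fixes x :: "'a \<Rightarrow> real"
  assumes "finite K"
  shows "(\<Sum>S\<in>Pow K. (sum x S - t)\<^sup>2) = 2 ^ card K * ((sum x K / 2 - t)\<^sup>2 + (\<Sum>i\<in>K. (x i)\<^sup>2) / 4)"
  using assms
proof (induction K arbitrary: t rule: finite_induct)
  case empty
  show ?case by simp
next
  case (insert a K)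
  have inj: "inj_on (insert a) (Pow K)" using insert.hyps(2) by (auto simp: inj_on_def)
  have disj: "Pow K \<inter> insert a ` Pow K = {}" using insert.hyps(2) by auto
  have "sum x (insert a S) - t = sum x S - (t - x a)" if "S \<in> Pow K" for S
    using that insert.hyps finite_subset[of S K] by (subst sum.insert) auto
  then have "(\<Sum>S\<in>insert a ` Pow K. (sum x S - t)\<^sup>2) = (\<Sum>S\<in>Pow K. (sum x S - (t - x a))\<^sup>2)"
    by (simp only: sum.reindex[OF inj] comp_def cong: sum.cong)
  then have "(\<Sum>S\<in>Pow (insert a K). (sum x S - t)\<^sup>2)
      = (\<Sum>S\<in>Pow K. (sum x S - t)\<^sup>2) + (\<Sum>S\<in>Pow K. (sum x S - (t - x a))\<^sup>2)"
    unfolding Pow_insert using insert.hyps(1) disj by (subst sum.union_disjoint) auto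
  also have "\<dots> = 2 ^ card K * ((sum x K / 2 - t)\<^sup>2 + (\<Sum>i\<in>K. (x i)\<^sup>2) / 4)
      + 2 ^ card K * ((sum x K / 2 - (t - x a))\<^sup>2 + (\<Sum>i\<in>K. (x i)\<^sup>2) / 4)"
    by (simp only: insert.IH)
  also have "\<dots> = 2 ^ card (insert a K)
      * ((sum x (insert a K) / 2 - t)\<^sup>2 + (\<Sum>i\<in>insert a K. (x i)\<^sup>2) / 4)"
    using insert.hyps by (simp add: power2_eq_square algebra_simps add_divide_distrib)
  finally show ?case .
qed

text \<open>
  If some weighted column is below the average \<open>\<tau>\<close> and another one above, a Givens rotation of these two
  columns brings the first to exactly \<open>\<tau>\<close>, so the number of columns off the average decreases.
\<close>

lemma exists_equalizing_rotation:
  fixes d :: "nat \<Rightarrow> real"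
  assumes "orthonormal k k R" "(\<Sum>i<k. d i) = real k * \<tau>"
  shows "\<exists>R'. orthonormal k k R' \<and> (\<forall>l<k. (\<Sum>i<k. d i * (R' i l)\<^sup>2) = \<tau>)"
  using assms(1)
proof (induction "card {l. l < k \<and> (\<Sum>i<k. d i * (R i l)\<^sup>2) \<noteq> \<tau>}" arbitrary: R rule: less_induct)
  case less
  define h where "h = (\<lambda>(R :: nat \<Rightarrow> nat \<Rightarrow> real) l. \<Sum>i<k. d i * (R i l)\<^sup>2)"
  \<comment> \<open>The rows of \<open>R\<close> are unit vectors, so the column weights
    \<open>h R l\<close> sum to the total of \<open>d\<close> and average to \<tau>.\<close>
  have total: "(\<Sum>l<k. h R l) = real k * \<tau>"
  proof -
    have "(\<Sum>l<k. h R l) = (\<Sum>i<k. \<Sum>l<k. d i * (R i l)\<^sup>2)"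
      unfolding h_def by (rule sum.swap)
    also have "\<dots> = (\<Sum>i<k. d i * ip k (R i) (R i))"
      by (simp add: ip_def sum_distrib_left power2_eq_square)
    also have "\<dots> = (\<Sum>i<k. d i)" using less.prems by (simp add: orthonormal_def)
    finally show ?thesis using assms(2) by simp
  qed
  show ?case
  proof (cases "\<forall>l<k. h R l = \<tau>")
    case True
    then show ?thesis using less.prems unfolding h_def by blast
  next
    case False
    have zero: "(\<Sum>l<k. h R l - \<tau>) = 0" using total by (simp add: sum_subtractf)
    have "\<exists>a<k. h R a < \<tau>"
    proof (rule ccontr)
      assume "\<not> ?thesis"
      then have "\<forall>l<k. h R l - \<tau> = 0"
        using zero sum_nonneg_eq_0_iff[of "{..<k}" "\<lambda>l. h R l - \<tau>"] by force
      then show False using False by simp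
    qed
    then obtain a where a: "a < k" "h R a < \<tau>" by blast
    have "\<exists>b<k. \<tau> < h R b"
    proof (rule ccontr)
      assume "\<not> ?thesis"
      then have "\<forall>l<k. \<tau> - h R l = 0"
        using zero sum_nonneg_eq_0_iff[of "{..<k}" "\<lambda>l. \<tau> - h R l"] by (force simp: sum_subtractf)
      then show False using False by auto
    qed
    then obtain b where b: "b < k" "\<tau> < h R b" by blast
    have ab: "a \<noteq> b" using a b by auto
    define G where "G = (\<lambda>\<theta> i l. if l = a then cos \<theta> * R i a + sin \<theta> * R i b
      else if l = b then cos \<theta> * R i b - sin \<theta> * R i a else R i l)"
    have Ga: "h (G \<theta>) a = (\<Sum>i<k. d i * (cos \<theta> * R i a + sin \<theta> * R i b)\<^sup>2)" for \<theta>
      by (simp add: h_def G_def)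
    have cont: "continuous_on {0..pi/2} (\<lambda>\<theta>. h (G \<theta>) a)"
      unfolding Ga by (intro continuous_intros)
    \<comment> \<open>Between these two angles the weight of column \<open>a\<close> moves
      continuously from below \<tau> to above it.\<close>
    have "h (G 0) a = h R a" "h (G (pi/2)) a = h R b"
      unfolding Ga by (simp_all add: h_def)
    then obtain \<theta> where \<theta>: "h (G \<theta>) a = \<tau>"
      using IVT'[of "\<lambda>\<theta>. h (G \<theta>) a" 0 \<tau> "pi/2"] cont a b by auto
    have ip_split: "ip k x y = x a * y a + (x b * y b + (\<Sum>l\<in>{..<k} - {a} - {b}. x l * y l))" for x y
      unfolding ip_def using a(1) b(1) ab by (simp add: sum.remove[of _ a] sum.remove[of "{..<k} - {a}" b])
    have "ip k (G \<theta> i) (G \<theta> j) = ip k (R i) (R j)" for i j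
    proof -
      have "(\<Sum>l\<in>{..<k} - {a} - {b}. G \<theta> i l * G \<theta> j l) = (\<Sum>l\<in>{..<k} - {a} - {b}. R i l * R j l)"
        by (intro sum.cong) (auto simp: G_def)
      moreover have "(c * x + s * y) * (c * x' + s * y') + (c * y - s * x) * (c * y' - s * x')
        = (s\<^sup>2 + c\<^sup>2) * (x * x' + y * y')" for c s x y x' y' :: real
        by (simp add: power2_eq_square algebra_simps)
      from this[of "cos \<theta>" "R i a" "sin \<theta>" "R i b" "R j a" "R j b"]
      have "G \<theta> i a * G \<theta> j a + G \<theta> i b * G \<theta> j b = R i a * R j a + R i b * R j b"
        using ab by (simp add: G_def)
      ultimately show ?thesis unfolding ip_split by simp
    qed
    then have orth: "orthonormal k k (G \<theta>)" using less.prems by (simp add: orthonormal_def)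
    have rest: "h (G \<theta>) l = h R l" if "l \<noteq> a" "l \<noteq> b" for l
      using that by (simp add: h_def G_def)
    \<comment> \<open>Only columns \<open>a\<close> and \<open>b\<close> change: \<open>a\<close>
      now attains \<tau>, and \<open>b\<close> was off it already.\<close>
    have "{l. l < k \<and> h (G \<theta>) l \<noteq> \<tau>} \<subset> {l. l < k \<and> h R l \<noteq> \<tau>}"
    proof -
      have "h R l \<noteq> \<tau>" if "h (G \<theta>) l \<noteq> \<tau>" for l
        using that \<theta> rest[of l] b(2) by (cases "l = a"; cases "l = b") simp_all
      moreover have "a \<in> {l. l < k \<and> h R l \<noteq> \<tau>}" "a \<notin> {l. l < k \<and> h (G \<theta>) l \<noteq> \<tau>}"
        using \<theta> a by simp_all
      ultimately show ?thesis by blast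
    qed
    then have "card {l. l < k \<and> h (G \<theta>) l \<noteq> \<tau>} < card {l. l < k \<and> h R l \<noteq> \<tau>}"
      by (intro psubset_card_mono) auto
    then show ?thesis using less.hyps[of "G \<theta>"] orth unfolding h_def by blast
  qed
qed

text \<open>Each entry of the masked product is a subset sum, so \<open>sum_Pow_square\<close>
  applies entrywise. Its variance terms are entries of the rank-one matrices of column pairs, whose
  squares sum to products of squared column lengths.\<close>

lemma dropout_loss_eq:
  assumes U: "U \<in> carrier_mat m k" and V: "V \<in> carrier_mat n k" and M: "M \<in> carrier_mat m n"
  defines "D \<equiv> \<lambda>a b. entries (U * transpose_mat V) a b - 2 * entries M a b"
  shows "dropout_loss k M U V = 1 / (2 ^ k - 1) * (2 ^ k * (1/4 * fip m n D D
    + 1/4 * (\<Sum>i<k. (L2_set (columns U i) {..<m} * L2_set (columns V i) {..<n})\<^sup>2)) - fip m n (entries M) (entries M))"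
proof -
  define x where "x = (\<lambda>a b i. columns U i a * columns V i b)"
  have ent: "entries (U * Pi_S k S * transpose_mat V) a b = sum (x a b) S"
    if "a < m" "b < n" "S \<subseteq> {0..<k}" for a b S
  proof -
    have "Pi_S k S = diag_k k (\<lambda>i. if i \<in> S then 1 else 0)"
      by (auto simp: Pi_S_def diag_k_def)
    then have "entries (U * Pi_S k S * transpose_mat V) a b = (\<Sum>i<k. (if i \<in> S then 1 else 0) * columns U i a * columns V i b)"
      using entries_mult_diag_transpose[OF U V that(1,2)] by simp
    also have "\<dots> = (\<Sum>i<k. if i \<in> S then x a b i else 0)"
      by (intro sum.cong) (auto simp: x_def)
    also have "\<dots> = sum (x a b) ({..<k} \<inter> S)" by (simp add: sum.inter_restrict)
    also have "{..<k} \<inter> S = S" using that(3) by auto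
    finally show ?thesis .
  qed
  have frob: "(frob_norm (U * Pi_S k S * transpose_mat V - M))\<^sup>2
      = (\<Sum>a<m. \<Sum>b<n. (sum (x a b) S - entries M a b)\<^sup>2)" if "S \<subseteq> {0..<k}" for S
  proof -
    have "U * Pi_S k S * transpose_mat V \<in> carrier_mat m n"
      using U V by (intro mult_carrier_mat[of _ _ k]) (auto simp: Pi_S_def)
    from frob_norm_diff_power2[OF this M] show ?thesis
      using ent[OF _ _ that] by (simp add: fip_def ip_def power2_eq_square)
  qed
  have set: "{S. S \<subseteq> {0..<k} \<and> S \<noteq> {}} = Pow {0..<k} - {{}}" by auto
  have "(\<Sum>S\<in>{S. S \<subseteq> {0..<k} \<and> S \<noteq> {}}. (frob_norm (U * Pi_S k S * transpose_mat V - M))\<^sup>2)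
      = (\<Sum>S\<in>Pow {0..<k} - {{}}. \<Sum>a<m. \<Sum>b<n. (sum (x a b) S - entries M a b)\<^sup>2)"
    unfolding set by (intro sum.cong refl frob) auto
  \<comment> \<open>The omitted empty set would contribute the squared norm of
    \<open>M\<close>.\<close>
  also have "\<dots> = (\<Sum>S\<in>Pow {0..<k}. \<Sum>a<m. \<Sum>b<n. (sum (x a b) S - entries M a b)\<^sup>2)
      - fip m n (entries M) (entries M)"
    by (subst sum_diff) (simp_all add: fip_def ip_def power2_eq_square)
  also have "(\<Sum>S\<in>Pow {0..<k}. \<Sum>a<m. \<Sum>b<n. (sum (x a b) S - entries M a b)\<^sup>2)
      = (\<Sum>a<m. \<Sum>b<n. \<Sum>S\<in>Pow {0..<k}. (sum (x a b) S - entries M a b)\<^sup>2)"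
    by (subst sum.swap, subst (2) sum.swap) simp
  also have "\<dots> = (\<Sum>a<m. \<Sum>b<n. 2 ^ k * (1/4 * (D a b)\<^sup>2 + 1/4 * (\<Sum>i<k. (x a b i)\<^sup>2)))"
  proof (intro sum.cong refl)
    fix a b assume ab: "a \<in> {..<m}" "b \<in> {..<n}"
    have "D a b = sum (x a b) {0..<k} - 2 * entries M a b"
      using entries_mult_transpose[OF U V, of a b] ab by (simp add: D_def x_def atLeast0LessThan)
    then have "1/4 * (D a b)\<^sup>2 = (sum (x a b) {0..<k} / 2 - entries M a b)\<^sup>2"
      by (simp only:) (simp add: power2_eq_square algebra_simps)
    then show "(\<Sum>S\<in>Pow {0..<k}. (sum (x a b) S - entries M a b)\<^sup>2)
        = 2 ^ k * (1/4 * (D a b)\<^sup>2 + 1/4 * (\<Sum>i<k. (x a b i)\<^sup>2))"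
      by (simp add: sum_Pow_square atLeast0LessThan)
  qed
  also have "\<dots> = 2 ^ k * (1/4 * fip m n D D + 1/4 * (\<Sum>a<m. \<Sum>b<n. \<Sum>i<k. (x a b i)\<^sup>2))"
    by (simp add: fip_def ip_def power2_eq_square[of "D _ _"] sum_distrib_left sum.distrib distrib_left)
  also have "(\<Sum>a<m. \<Sum>b<n. \<Sum>i<k. (x a b i)\<^sup>2)
      = (\<Sum>i<k. (L2_set (columns U i) {..<m} * L2_set (columns V i) {..<n})\<^sup>2)"
  proof -
    have "(\<Sum>a<m. \<Sum>b<n. \<Sum>i<k. (x a b i)\<^sup>2) = (\<Sum>a<m. \<Sum>i<k. \<Sum>b<n. (x a b i)\<^sup>2)"
      by (intro sum.cong refl sum.swap)
    also have "\<dots> = (\<Sum>i<k. \<Sum>a<m. \<Sum>b<n. (x a b i)\<^sup>2)" by (rule sum.swap)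
    also have "\<dots> = (\<Sum>i<k. (L2_set (columns U i) {..<m} * L2_set (columns V i) {..<n})\<^sup>2)"
      unfolding power_mult_distrib L2_set_power2_eq_ip x_def
      by (simp add: ip_def sum_product power2_eq_square)
    finally show ?thesis .
  qed
  finally show ?thesis unfolding dropout_loss_def by simp
qed

section \<open>The minimizer\<close>

text \<open>The difference of the two sides changes sign between 0 and \<open>T\<close>, where
  \<open>T\<close> is so large that every maximum is zero.\<close>

lemma exists_threshold:
  fixes \<sigma> :: "nat \<Rightarrow> real"
  shows "\<exists>\<tau>\<ge>0. real k * \<tau> = (\<Sum>i<k. max (2 * \<sigma> i - \<tau>) 0)"
proof -
  define g where "g = (\<lambda>\<tau>. (\<Sum>i<k. max (2 * \<sigma> i - \<tau>) 0) - real k * \<tau>)"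
  define T where "T = (\<Sum>i<k. 2 * \<bar>\<sigma> i\<bar>)"
  have T: "0 \<le> T" unfolding T_def by (intro sum_nonneg) simp
  have "2 * \<sigma> i - T \<le> 0" if "i < k" for i
  proof -
    have "2 * \<bar>\<sigma> i\<bar> \<le> T" unfolding T_def by (rule member_le_sum) (use that in auto)
    then show ?thesis by linarith
  qed
  then have "(\<Sum>i<k. max (2 * \<sigma> i - T) 0) = 0" by (intro sum.neutral) (auto simp: max_def intro: antisym)
  then have "g T \<le> 0" using T by (simp add: g_def)
  moreover have "0 \<le> g 0" unfolding g_def by (simp add: sum_nonneg)
  moreover have "continuous_on {0..T} g" unfolding g_def by (intro continuous_intros)
  ultimately obtain \<tau> where "0 \<le> \<tau>" "g \<tau> = 0" using IVT2'[of g T 0 0] T by auto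
  then show ?thesis by (auto simp: g_def)
qed

text \<open>Both factors are the singular vectors scaled by \<open>sqrt (d i)\<close> and then
  multiplied by the same orthogonal \<open>R\<close>. This \<open>R\<close> cancels in the product,
  while the squared column lengths become the weights it equalizes.\<close>

lemma balanced_factorization:
  fixes d :: "nat \<Rightarrow> real"
  assumes p: "orthonormal m k p" and q: "orthonormal n k q"
    and d: "\<And>i. i < k \<Longrightarrow> 0 \<le> d i" "(\<Sum>i<k. d i) = real k * \<tau>"
  obtains u v where "\<And>l. l < k \<Longrightarrow> ip m (u l) (u l) = \<tau>" "\<And>l. l < k \<Longrightarrow> ip n (v l) (v l) = \<tau>"
    "\<And>a b. (\<Sum>l<k. u l a * v l b) = (\<Sum>i<k. d i * p i a * q i b)"
proof -
  have "orthonormal k k coord" by (simp add: orthonormal_def ip_coord_right) (simp add: coord_def)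
  then obtain R where R: "orthonormal k k R" "\<And>l. l < k \<Longrightarrow> (\<Sum>i<k. d i * (R i l)\<^sup>2) = \<tau>"
    using exists_equalizing_rotation d(2) by blast
  define u where "u = (\<lambda>l a. \<Sum>i<k. (sqrt (d i) * R i l) * p i a)"
  define v where "v = (\<lambda>l b. \<Sum>i<k. (sqrt (d i) * R i l) * q i b)"
  have sq: "(\<Sum>i<k. (sqrt (d i) * R i l)\<^sup>2) = \<tau>" if "l < k" for l
    using R(2)[OF that] d(1) by (simp add: power_mult_distrib)
  show thesis
  proof (rule that[of u v])
    show "ip m (u l) (u l) = \<tau>" "ip n (v l) (v l) = \<tau>" if "l < k" for l
      unfolding u_def v_def ip_orthonormal_combination[OF p] ip_orthonormal_combination[OF q]
      by (simp_all add: sq[OF that])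
    fix a b
    have "(\<Sum>l<k. u l a * v l b)
        = (\<Sum>l<k. \<Sum>i<k. \<Sum>j<k. (sqrt (d i) * p i a * sqrt (d j) * q j b) * (R i l * R j l))"
      unfolding u_def v_def sum_product by (simp add: mult_ac)
    also have "\<dots> = (\<Sum>i<k. \<Sum>l<k. \<Sum>j<k. (sqrt (d i) * p i a * sqrt (d j) * q j b) * (R i l * R j l))"
      by (rule sum.swap)
    also have "\<dots> = (\<Sum>i<k. \<Sum>j<k. \<Sum>l<k. (sqrt (d i) * p i a * sqrt (d j) * q j b) * (R i l * R j l))"
      by (intro sum.cong refl sum.swap)
    also have "\<dots> = (\<Sum>i<k. \<Sum>j<k. (sqrt (d i) * p i a * sqrt (d j) * q j b) * ip k (R i) (R j))"
      by (simp add: ip_def sum_distrib_left)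
    also have "\<dots> = (\<Sum>i<k. \<Sum>j<k. if j = i then sqrt (d i) * p i a * sqrt (d j) * q j b else 0)"
      using R(1) by (intro sum.cong) (auto simp: orthonormal_def)
    also have "\<dots> = (\<Sum>i<k. d i * p i a * q i b)"
      using d(1) by (intro sum.cong) (auto simp: mult_ac)
    finally show "(\<Sum>l<k. u l a * v l b) = (\<Sum>i<k. d i * p i a * q i b)" .
  qed
qed

text \<open>
  \<open>2 M - W0\<close> has singular values \<open>min (2 \<sigma> i) \<tau>\<close>, hence it is \<open>\<tau>\<close> times a subgradient of the nuclear norm
  at \<open>W0\<close>; this is the optimality condition for \<open>\<Phi>\<close>.
\<close>

lemma shrinkage_certificate:
  fixes \<tau> :: real
  assumes M: "svd_form m n k M p \<sigma> q" and \<tau>: "0 \<le> \<tau>" "real k * \<tau> = (\<Sum>i<k. max (2 * \<sigma> i - \<tau>) 0)"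
    and W0: "\<And>a b. a < m \<Longrightarrow> b < n \<Longrightarrow> W0 a b = (\<Sum>i<k. max (2 * \<sigma> i - \<tau>) 0 * p i a * q i b)"
  shows "contraction m n \<tau> (\<lambda>a b. 2 * M a b - W0 a b)"
    and "fip m n (\<lambda>a b. 2 * M a b - W0 a b) W0 = \<tau> * (real k * \<tau>)"
proof -
  define d where "d = (\<lambda>i. max (2 * \<sigma> i - \<tau>) 0)"
  define y where "y = (\<lambda>i. 2 * \<sigma> i - d i)"
  have pq: "orthonormal m k p" "orthonormal n k q" and \<sigma>: "\<And>i. i < k \<Longrightarrow> 0 \<le> \<sigma> i"
    using M by (auto simp: svd_form_def)
  have Y: "2 * M a b - W0 a b = (\<Sum>i<k. y i * p i a * q i b)" if "a < m" "b < n" for a b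
  proof -
    have "2 * M a b - W0 a b = (\<Sum>i<k. 2 * (\<sigma> i * p i a * q i b) - d i * p i a * q i b)"
      using M that W0[OF that] by (simp add: svd_form_def d_def sum_subtractf sum_distrib_left)
    also have "\<dots> = (\<Sum>i<k. y i * p i a * q i b)"
      by (intro sum.cong) (auto simp: y_def algebra_simps)
    finally show ?thesis .
  qed
  have "contraction m n \<tau> (\<lambda>a b. \<Sum>i<k. y i * p i a * q i b)"
    by (rule contraction_sum_rank_one[OF pq _ _ \<tau>(1)]) (use \<sigma> \<tau>(1) in \<open>auto simp: y_def d_def max_def\<close>)
  moreover have "bil m n (\<lambda>a b. 2 * M a b - W0 a b) x z = bil m n (\<lambda>a b. \<Sum>i<k. y i * p i a * q i b) x z" for x z
    using Y by (rule bil_cong)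
  ultimately show "contraction m n \<tau> (\<lambda>a b. 2 * M a b - W0 a b)" by (simp add: contraction_def)
  have "fip m n (\<lambda>a b. 2 * M a b - W0 a b) W0
      = fip m n (\<lambda>a b. \<Sum>i<k. y i * p i a * q i b) (\<lambda>a b. \<Sum>i<k. d i * p i a * q i b)"
    using Y W0 by (intro fip_cong) (auto simp: d_def)
  also have "\<dots> = (\<Sum>i<k. d i * y i)"
    unfolding fip_sum_rank_one using bil_sum_rank_one_diag[OF pq] by (intro sum.cong) auto
  \<comment> \<open>Complementary slackness: either \<open>d i = 0\<close> or
    \<open>y i = \<tau>\<close>.\<close>
  also have "\<dots> = (\<Sum>i<k. \<tau> * d i)"
    by (intro sum.cong) (auto simp: y_def d_def max_def)
  also have "\<dots> = \<tau> * (real k * \<tau>)" using \<tau>(2) by (simp add: d_def sum_distrib_left)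
  finally show "fip m n (\<lambda>a b. 2 * M a b - W0 a b) W0 = \<tau> * (real k * \<tau>)" .
qed

text \<open>Indices start at 0, so \<open>\<sigma> (k - 1)\<close> is the smallest singular value.
  For \<open>k = 1\<close> all singular values coincide trivially and the minimizer is
  \<open>M\<close>; strict positivity is therefore claimed for \<open>2 \<le> k\<close>.\<close>

theorem theoremB7:
  fixes m n k :: nat and M P Q Wst :: "real mat" and \<sigma> :: "nat \<Rightarrow> real"
  assumes "0 < m" and "0 < n" and "k = min m n"
    and "M \<in> carrier_mat m n"
    and svd: "is_svd M P \<sigma> Q"
    and pos: "\<sigma> (k - 1) > 0"
    and Wmin: "Wst \<in> carrier_mat m n" "\<forall>W\<in>carrier_mat m n. Phi k M Wst \<le> Phi k M W"
    and Wuniq: "\<forall>W\<in>carrier_mat m n. (\<forall>W'\<in>carrier_mat m n. Phi k M W \<le> Phi k M W') \<longrightarrow> W = Wst"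
  shows "(Wst = M \<longleftrightarrow> (\<forall>i<k. \<sigma> i = \<sigma> 0)) \<and>
         ((\<forall>i j. i < j \<and> j < k \<longrightarrow> \<sigma> j < \<sigma> i) \<longrightarrow>
            (\<forall>U\<in>carrier_mat m k. \<forall>V\<in>carrier_mat n k.
               (\<forall>U'\<in>carrier_mat m k. \<forall>V'\<in>carrier_mat n k.
                  dropout_loss k M U V \<le> dropout_loss k M U' V') \<longrightarrow>
               (frob_norm (U * transpose_mat V - M))^2 = (frob_norm (Wst - M))^2) \<and>
            (2 \<le> k \<longrightarrow> (frob_norm (Wst - M))^2 > 0))"
proof -
  note Mc = \<open>M \<in> carrier_mat m n\<close>
  have k: "0 < k" using assms(1-3) by simp
  have Pc: "P \<in> carrier_mat m k" and Qc: "Q \<in> carrier_mat n k"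
    using is_svd_carrier[OF svd Mc] \<open>k = min m n\<close> by auto
  define p where "p = columns P"
  define q where "q = columns Q"
  have M_svd: "svd_form m n k (entries M) p \<sigma> q"
    using svd is_svd_iff_svd_form[OF Mc] Pc Qc \<open>k = min m n\<close> by (simp add: p_def q_def)
  then have pq: "orthonormal m k p" "orthonormal n k q"
    and dec: "\<And>i j. i \<le> j \<Longrightarrow> j < k \<Longrightarrow> \<sigma> j \<le> \<sigma> i" by (auto simp: svd_form_def)
  have \<sigma>_pos: "0 < \<sigma> i" if "i < k" for i
    using dec[of i "k - 1"] that pos by force

  \<comment> \<open>The shrunken matrix and its certificate\<close>
  obtain \<tau> where \<tau>: "0 \<le> \<tau>" "real k * \<tau> = (\<Sum>i<k. max (2 * \<sigma> i - \<tau>) 0)"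
    using exists_threshold by blast
  define d where "d = (\<lambda>i. max (2 * \<sigma> i - \<tau>) 0)"
  define W0 where "W0 = P * diag_k k d * transpose_mat Q"
  have W0c: "W0 \<in> carrier_mat m n"
    unfolding W0_def using Pc Qc by (intro mult_carrier_mat[of _ _ k]) (auto simp: diag_k_def)
  have W0: "entries W0 a b = (\<Sum>i<k. d i * p i a * q i b)" if "a < m" "b < n" for a b
    unfolding W0_def p_def q_def using entries_mult_diag_transpose[OF Pc Qc that] .
  have W0_svd: "svd_form m n k (entries W0) p d q"
  proof -
    have "d j \<le> d i" if "i \<le> j" "j < k" for i j
      using dec[OF that] unfolding d_def by (intro max.mono) auto
    then show ?thesis using pq W0 by (auto simp: svd_form_def d_def)
  qed
  have W0_nuc: "nuc_norm W0 = real k * \<tau>"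
    using nuc_norm_eq[OF _ W0c, of P d Q] is_svd_iff_svd_form[OF W0c, of P Q d] Pc Qc W0_svd \<open>k = min m n\<close> \<tau>(2)
    by (simp add: p_def q_def d_def)
  note cert = shrinkage_certificate[OF M_svd \<tau>, of "entries W0", OF W0[unfolded d_def]]

  \<comment> \<open>Here \<open>N\<close> is the nuclear norm of \<open>W\<close>, and the
    nonnegative square of \<open>W - W0\<close> is dropped.\<close>
  have "Phi k M W0 \<le> Phi k M W" if W: "W \<in> carrier_mat m n" for W
    using fip_quadratic_lower_bound[OF k cert(2) fip_le_nuc_norm[OF W cert(1)]]
      fip_self_nonneg[of m n "\<lambda>a b. entries W a b - entries W0 a b"]
    unfolding Phi_eq[OF Mc W] Phi_eq[OF Mc W0c] W0_nuc by linarith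
  then have Wst: "Wst = W0" using Wuniq W0c by blast

  \<comment> \<open>Equality with \<open>M\<close> and equal singular values\<close>
  have iff: "W0 = M \<longleftrightarrow> (\<forall>i<k. \<sigma> i = \<sigma> 0)"
  proof
    assume "W0 = M"
    have "\<sigma> l = \<tau>" if "l < k" for l
    proof -
      have "bil m n (entries M) (p l) (q l) = \<sigma> l"
        using M_svd that by (rule svd_form_bil_diag)
      moreover have "bil m n (entries W0) (p l) (q l) = d l"
        using W0_svd that by (rule svd_form_bil_diag)
      ultimately have "d l = \<sigma> l" using \<open>W0 = M\<close> by simp
      \<comment> \<open>Positivity rules out the truncated branch, and
        \<open>2 \<sigma> l - \<tau> = \<sigma> l\<close> gives \<tau>.\<close>
      then show ?thesis using \<sigma>_pos[OF that] by (simp add: d_def max_def split: if_splits)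
    qed
    then show "\<forall>i<k. \<sigma> i = \<sigma> 0" using k by simp
  next
    assume "\<forall>i<k. \<sigma> i = \<sigma> 0"
    then obtain s where s: "\<And>i. i < k \<Longrightarrow> \<sigma> i = s" by blast
    then have "real k * \<tau> = real k * max (2 * s - \<tau>) 0" using \<tau>(2) by simp
    then have "\<tau> = max (2 * s - \<tau>) 0" using k by simp
    then have "\<tau> = s" using \<sigma>_pos[OF k] s[OF k] by (simp add: max_def split: if_splits)
    then have "d i = \<sigma> i" if "i < k" for i
      using s[OF that] \<sigma>_pos[OF that] by (simp add: d_def)
    then have "diag_k k d = diag_k k \<sigma>" by (auto simp: diag_k_def)
    then show "W0 = M" using svd Mc \<open>k = min m n\<close> by (auto simp: W0_def is_svd_def Let_def)
  qed

  \<comment> \<open>Sharp lower bound for the dropout loss\<close>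
  define C0 where "C0 = 1/4 * fip m n (\<lambda>a b. entries W0 a b - 2 * entries M a b) (\<lambda>a b. entries W0 a b - 2 * entries M a b)
    + 1 / (4 * real k) * (real k * \<tau>)\<^sup>2"
  \<comment> \<open>\<open>C0\<close> is the value of \<open>Phi\<close> at \<open>W0\<close>; the
    loss is an increasing affine function of \<open>J\<close>.\<close>
  define J where "J = (\<lambda>U V. 1/4 * fip m n (\<lambda>a b. entries (U * transpose_mat V) a b - 2 * entries M a b)
      (\<lambda>a b. entries (U * transpose_mat V) a b - 2 * entries M a b)
    + 1/4 * (\<Sum>i<k. (L2_set (columns U i) {..<m} * L2_set (columns V i) {..<n})\<^sup>2))"
  have loss: "dropout_loss k M U V = 1 / (2 ^ k - 1) * (2 ^ k * J U V - fip m n (entries M) (entries M))"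
    if "U \<in> carrier_mat m k" "V \<in> carrier_mat n k" for U V
    unfolding J_def by (rule dropout_loss_eq[OF that Mc])
  have J_ge: "C0 + 1/4 * fip m n (\<lambda>a b. entries (U * transpose_mat V) a b - entries W0 a b)
      (\<lambda>a b. entries (U * transpose_mat V) a b - entries W0 a b) \<le> J U V"
    if UV: "U \<in> carrier_mat m k" "V \<in> carrier_mat n k" for U V
  proof -
    define N where "N = (\<Sum>i<k. L2_set (columns U i) {..<m} * L2_set (columns V i) {..<n})"
    have "fip m n (\<lambda>a b. 2 * entries M a b - entries W0 a b) (entries (U * transpose_mat V))
        = fip m n (\<lambda>a b. 2 * entries M a b - entries W0 a b) (\<lambda>a b. \<Sum>i<k. 1 * columns U i a * columns V i b)"
      using entries_mult_transpose[OF UV] by (intro fip_cong) auto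
    also have "\<dots> \<le> \<tau> * N"
      using fip_contraction_sum_rank_one_le[OF cert(1), of "{..<k}" "\<lambda>_. 1" "columns U" "columns V"]
      by (simp add: N_def)
    finally have *: "fip m n (\<lambda>a b. 2 * entries M a b - entries W0 a b) (entries (U * transpose_mat V)) \<le> \<tau> * N" .
    \<comment> \<open>Cauchy-Schwarz against the constant vector; equality needs all products of
      column lengths to agree, which the balanced factorization below provides.\<close>
    have "N\<^sup>2 \<le> real k * (\<Sum>i<k. (L2_set (columns U i) {..<m} * L2_set (columns V i) {..<n})\<^sup>2)"
      unfolding N_def using sum_squared_le_sum_of_squares[of "\<lambda>i. L2_set (columns U i) {..<m} * L2_set (columns V i) {..<n}" "{..<k}"]
      by (simp add: mult.commute)
    then have "1 / (4 * real k) * N\<^sup>2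
        \<le> 1/4 * (\<Sum>i<k. (L2_set (columns U i) {..<m} * L2_set (columns V i) {..<n})\<^sup>2)"
      using k by (simp add: field_simps)
    then show ?thesis
      using fip_quadratic_lower_bound[OF k cert(2) *] unfolding C0_def J_def by linarith
  qed
  have "\<exists>U\<in>carrier_mat m k. \<exists>V\<in>carrier_mat n k. J U V = C0"
  proof -
    have dsum: "(\<Sum>i<k. d i) = real k * \<tau>" using \<tau>(2) by (simp add: d_def)
    obtain u v where u: "\<And>l. l < k \<Longrightarrow> ip m (u l) (u l) = \<tau>" and v: "\<And>l. l < k \<Longrightarrow> ip n (v l) (v l) = \<tau>"
      and uv: "\<And>a b. (\<Sum>l<k. u l a * v l b) = (\<Sum>i<k. d i * p i a * q i b)"
      using balanced_factorization[OF pq _ dsum] by (auto simp: d_def)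
    define U where "U = mat m k (\<lambda>(a, l). u l a)"
    define V where "V = mat n k (\<lambda>(b, l). v l b)"
    have UV: "U \<in> carrier_mat m k" "V \<in> carrier_mat n k" by (auto simp: U_def V_def)
    have "(L2_set (columns U l) {..<m} * L2_set (columns V l) {..<n})\<^sup>2 = \<tau>\<^sup>2" if "l < k" for l
    proof -
      have "ip m (columns U l) (columns U l) = \<tau>" "ip n (columns V l) (columns V l) = \<tau>"
        using u[OF that] v[OF that] that by (simp_all add: ip_def columns_def U_def V_def)
      then show ?thesis by (simp add: power_mult_distrib L2_set_power2_eq_ip power2_eq_square[of \<tau>])
    qed
    then have "(\<Sum>l<k. (L2_set (columns U l) {..<m} * L2_set (columns V l) {..<n})\<^sup>2) = real k * \<tau>\<^sup>2"
      by simp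
    moreover have "entries (U * transpose_mat V) a b = entries W0 a b" if "a < m" "b < n" for a b
      using that by (simp add: entries_mult_transpose[OF UV] W0 uv[symmetric]) (simp add: columns_def U_def V_def)
    then have "fip m n (\<lambda>a b. entries (U * transpose_mat V) a b - 2 * entries M a b)
        (\<lambda>a b. entries (U * transpose_mat V) a b - 2 * entries M a b)
      = fip m n (\<lambda>a b. entries W0 a b - 2 * entries M a b) (\<lambda>a b. entries W0 a b - 2 * entries M a b)"
      by (intro fip_cong) auto
    ultimately have "J U V = C0"
      using k unfolding J_def C0_def by (simp add: power2_eq_square)
    then show ?thesis using UV by blast
  qed
  then obtain U0 V0 where U0: "U0 \<in> carrier_mat m k" and V0: "V0 \<in> carrier_mat n k" and J0: "J U0 V0 = C0"
    by blast
  have opt: "U * transpose_mat V = W0"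
    if UV: "U \<in> carrier_mat m k" "V \<in> carrier_mat n k"
      and min: "\<forall>U'\<in>carrier_mat m k. \<forall>V'\<in>carrier_mat n k. dropout_loss k M U V \<le> dropout_loss k M U' V'" for U V
  proof -
    have "(1::real) < 2 ^ k" using k by simp
    moreover have "dropout_loss k M U V \<le> dropout_loss k M U0 V0" using min U0 V0 by blast
    ultimately have "J U V \<le> C0"
      unfolding loss[OF UV] loss[OF U0 V0] J0 by (simp add: divide_le_cancel)
    \<comment> \<open>The quadratic gap in \<open>J_ge\<close> leaves no room, so the product itself
      is determined even though the factors are not.\<close>
    then have "fip m n (\<lambda>a b. entries (U * transpose_mat V) a b - entries W0 a b)
      (\<lambda>a b. entries (U * transpose_mat V) a b - entries W0 a b) \<le> 0"
      using J_ge[OF UV] by linarith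
    from fip_self_eq_0_D[OF this]
    have eq: "(U * transpose_mat V) $$ (a, b) = W0 $$ (a, b)" if "a < m" "b < n" for a b
      using that by (simp add: entries_def del: index_mult_mat(1))
    show ?thesis
      by (rule eq_matI) (use eq UV W0c in \<open>auto simp del: index_mult_mat(1)\<close>)
  qed
  have "(frob_norm (W0 - M))\<^sup>2 > 0" if strict: "\<forall>i j. i < j \<and> j < k \<longrightarrow> \<sigma> j < \<sigma> i" and "2 \<le> k"
  proof (rule ccontr)
    assume "\<not> ?thesis"
    then have "fip m n (\<lambda>a b. entries W0 a b - entries M a b) (\<lambda>a b. entries W0 a b - entries M a b) \<le> 0"
      unfolding frob_norm_diff_power2[OF W0c Mc] by simp
    from fip_self_eq_0_D[OF this] have "W0 = M"
      using W0c Mc by (intro eq_matI) (auto simp: entries_def)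
    then have "\<forall>i<k. \<sigma> i = \<sigma> 0" using iff by blast
    from this[rule_format, of 1] have "\<sigma> 1 = \<sigma> 0" using \<open>2 \<le> k\<close> by simp
    then show False using strict[rule_format, of 0 1] \<open>2 \<le> k\<close> by simp
  qed
  moreover have "(frob_norm (U * transpose_mat V - M))\<^sup>2 = (frob_norm (W0 - M))\<^sup>2"
    if "U \<in> carrier_mat m k" "V \<in> carrier_mat n k"
      "\<forall>U'\<in>carrier_mat m k. \<forall>V'\<in>carrier_mat n k. dropout_loss k M U V \<le> dropout_loss k M U' V'" for U V
    by (simp only: opt[OF that])
  ultimately show ?thesis unfolding Wst using iff by blast
qed

end
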